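(* Let $(H,\delta)$ be a Fredholm chain. Then there is an $\epsilon>0$ such that, for every sequence of spaces and maps $(H,\delta')$ (with the same Hilbert spaces $H_p$) for which $R(\delta'_p\delta'_{p+1})$ is finite dimensional for each $p\in\mathbb{Z}$, if $\|\delta_p-\delta'_p\|<\epsilon$ for all $p\in\mathbb{Z}$, then $(H,\delta')$ is a Fredholm chain and $\operatorname{ind}(H,\delta)=\operatorname{ind}(H,\delta')$.
   Context: $L(X,Y)$ denotes the bounded linear maps between Hilbert spaces $X$ and $Y$; $N(\cdot)$ and $R(\cdot)$ denote null space and range. A sequence of spaces and maps $(H,\delta)$ consists of Hilbert spaces $H_p$ and operators $\delta_p\in L(H_p,H_{p-1})$, $p\in\mathbb{Z}$, for which there is $n\in\mathbb{N}$ such that $H_p=0$ and $\delta_p=0$ for $p<0$ and for $p\ge n+1$; i.e. $0\to H_n\xrightarrow{\delta_n}H_{n-1}\to\cdots\to H_1\xrightarrow{\delta_1}H_0\to 0$ (with no requirement that $\delta_p\delta_{p+1}=0$). It is called a Fredholm chain if $N(\delta_p)/(N(\delta_p)\cap R(\delta_{p+1}))$ and $R(\delta_{p+1})/(N(\delta_p)\cap R(\delta_{p+1}))$ are finite dimensional for every $p=0,\dots,n$. The index of a Fredholm chain is $\operatorname{ind}(H,\delta)=\sum_{p=0}^n(-1)^p\big(\dim N(\delta_p)/(N(\delta_p)\cap R(\delta_{p+1}))-\dim R(\delta_{p+1})/(N(\delta_p)\cap R(\delta_{p+1}))\big)$. *)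

theory Defs
  imports "HOL-Analysis.Analysis"
begin

text \<open>The scalar field of a Hilbert space is real or complex. By Gelfand--Mazur these are
  the only fields of class \<^class>\<open>real_normed_field\<close>, and the conjugation is
  determined by the law \<open>mult_conj\<close>.\<close>

class real_or_complex = real_normed_field +
  fixes conj :: "'a \<Rightarrow> 'a"
  assumes conj_add: "conj (a + b) = conj a + conj b"
    and conj_mult: "conj (a * b) = conj a * conj b"
    and conj_conj: "conj (conj a) = a"
    and mult_conj: "a * conj a = (norm a)\<^sup>2 *\<^sub>R 1"

instantiation real :: real_or_complex
begin
definition conj_real :: "real \<Rightarrow> real" where "conj_real a = a"
instance by standard (simp_all add: conj_real_def power2_eq_square)
end

instantiation complex :: real_or_complex
begin
definition conj_complex :: "complex \<Rightarrow> complex" where "conj_complex a = cnj a"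
instance by standard (simp_all add: conj_complex_def scaleR_conv_of_real complex_norm_square[symmetric])
end

text \<open>A Hilbert space over \<open>'k\<close>. The class \<^class>\<open>real_inner\<close> supplies the norm and
  topology; its real inner product is the real part of \<open>ip\<close> (polarization).\<close>

locale hilbert_space = vector_space smul
  for smul :: "'k::real_or_complex \<Rightarrow> 'a::{real_inner, complete_space} \<Rightarrow> 'a" +
  fixes ip :: "'a \<Rightarrow> 'a \<Rightarrow> 'k"
  assumes scale_of_real: "smul (of_real r) x = r *\<^sub>R x"
    and ip_add_left: "ip (x + y) z = ip x z + ip y z"
    and ip_scale_left: "ip (smul c x) y = c * ip x y"
    and ip_commute: "ip y x = conj (ip x y)"
    and ip_self: "ip x x = of_real ((norm x)\<^sup>2)"

lemma hilbert_space_real: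
  "hilbert_space scaleR (inner :: 'a::{real_inner, complete_space} \<Rightarrow> 'a \<Rightarrow> real)"
  by unfold_locales
    (simp_all add: algebra_simps inner_add_left conj_real_def inner_commute power2_norm_eq_inner)

lemma hilbert_space_complex: "hilbert_space (*) (\<lambda>x y. x * cnj y)"
  by unfold_locales
    (simp_all add: algebra_simps conj_complex_def scaleR_conv_of_real complex_norm_square[symmetric])

text \<open>Operators between subspaces \<open>X\<close> and \<open>Y\<close> are represented by total functions of which
  only the values on \<open>X\<close> matter.\<close>

definition bounded_operators ::
  "('k::real_or_complex \<Rightarrow> 'a::real_normed_vector \<Rightarrow> 'a) \<Rightarrow> 'a set \<Rightarrow> 'a set \<Rightarrow> ('a \<Rightarrow> 'a) set"
  where "bounded_operators smul X Y =
    {f. f ` X \<subseteq> Y \<and>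
        (\<forall>x\<in>X. \<forall>y\<in>X. f (x + y) = f x + f y) \<and>
        (\<forall>c. \<forall>x\<in>X. f (smul c x) = smul c (f x)) \<and>
        (\<exists>K. \<forall>x\<in>X. norm (f x) \<le> K * norm x)}"

definition onorm_on :: "'a::real_normed_vector set \<Rightarrow> ('a \<Rightarrow> 'a) \<Rightarrow> real"
  where "onorm_on X f = (SUP x\<in>X. norm (f x) / norm x)"

definition ker_on :: "'a set \<Rightarrow> ('a \<Rightarrow> 'a::zero) \<Rightarrow> 'a set"
  where "ker_on X f = {x \<in> X. f x = 0}"

definition finite_dim :: "('k::field \<Rightarrow> 'a::ab_group_add \<Rightarrow> 'a) \<Rightarrow> 'a set \<Rightarrow> bool"
  where "finite_dim smul V \<longleftrightarrow> (\<exists>B. finite B \<and> V = module.span smul B)"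

text \<open>The quotient \<open>V/W\<close> of a subspace \<open>V\<close> by a subspace \<open>W \<subseteq> V\<close>. A linear combination of
  the cosets \<open>x + W\<close> is the coset of the linear combination of the representatives \<open>x\<close>; so
  \<open>quotient_basis smul V W F\<close> says that the cosets of the vectors in the finite set \<open>F\<close> are
  distinct and form a basis of \<open>V/W\<close>.\<close>

definition coset :: "'a::ab_group_add set \<Rightarrow> 'a \<Rightarrow> 'a set"
  where "coset W x = (\<lambda>w. x + w) ` W"

definition quotient_space :: "'a::ab_group_add set \<Rightarrow> 'a set \<Rightarrow> 'a set set"
  where "quotient_space V W = coset W ` V"

definition quotient_basis ::
  "('k::field \<Rightarrow> 'a::ab_group_add \<Rightarrow> 'a) \<Rightarrow> 'a set \<Rightarrow> 'a set \<Rightarrow> 'a set \<Rightarrow> bool"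
  where "quotient_basis smul V W F \<longleftrightarrow> finite F \<and> F \<subseteq> V \<and>
    (\<forall>u. coset W (\<Sum>x\<in>F. smul (u x) x) = coset W 0 \<longrightarrow> (\<forall>x\<in>F. u x = 0)) \<and>
    (\<forall>C\<in>quotient_space V W. \<exists>u. C = coset W (\<Sum>x\<in>F. smul (u x) x))"

definition quotient_finite_dim ::
  "('k::field \<Rightarrow> 'a::ab_group_add \<Rightarrow> 'a) \<Rightarrow> 'a set \<Rightarrow> 'a set \<Rightarrow> bool"
  where "quotient_finite_dim smul V W \<longleftrightarrow> (\<exists>F. quotient_basis smul V W F)"

definition quotient_dim ::
  "('k::field \<Rightarrow> 'a::ab_group_add \<Rightarrow> 'a) \<Rightarrow> 'a set \<Rightarrow> 'a set \<Rightarrow> nat"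
  where "quotient_dim smul V W = card (SOME F. quotient_basis smul V W F)"

text \<open>The spaces \<open>H p\<close> are closed subspaces of one ambient Hilbert space. This is no
  restriction: finitely many Hilbert spaces embed isometrically into their orthogonal direct
  sum. No relative position of the \<open>H p\<close> is assumed. The parameter \<open>n\<close> is a bound for the
  length of the sequence.\<close>

definition hilbert_sequence ::
  "('k::real_or_complex \<Rightarrow> 'a::{real_inner, complete_space} \<Rightarrow> 'a) \<Rightarrow> nat \<Rightarrow>
    (int \<Rightarrow> 'a set) \<Rightarrow> (int \<Rightarrow> 'a \<Rightarrow> 'a) \<Rightarrow> bool"
  where "hilbert_sequence smul n H \<delta> \<longleftrightarrow>
    (\<forall>p. module.subspace smul (H p) \<and> closed (H p)) \<and>
    (\<forall>p. \<delta> p \<in> bounded_operators smul (H p) (H (p - 1))) \<and>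
    (\<forall>p. p < 0 \<or> p \<ge> int n + 1 \<longrightarrow> H p = {0} \<and> (\<forall>x\<in>H p. \<delta> p x = 0))"

abbreviation Ns :: "(int \<Rightarrow> 'a set) \<Rightarrow> (int \<Rightarrow> 'a \<Rightarrow> 'a::zero) \<Rightarrow> int \<Rightarrow> 'a set"
  where "Ns H \<delta> p \<equiv> ker_on (H p) (\<delta> p)"

abbreviation Rs :: "(int \<Rightarrow> 'a set) \<Rightarrow> (int \<Rightarrow> 'a \<Rightarrow> 'a) \<Rightarrow> int \<Rightarrow> 'a set"
  where "Rs H \<delta> p \<equiv> \<delta> p ` H p"

definition fredholm_chain ::
  "('k::real_or_complex \<Rightarrow> 'a::{real_inner, complete_space} \<Rightarrow> 'a) \<Rightarrow> nat \<Rightarrow>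
    (int \<Rightarrow> 'a set) \<Rightarrow> (int \<Rightarrow> 'a \<Rightarrow> 'a) \<Rightarrow> bool"
  where "fredholm_chain smul n H \<delta> \<longleftrightarrow> hilbert_sequence smul n H \<delta> \<and>
    (\<forall>p\<in>{0..int n}.
      quotient_finite_dim smul (Ns H \<delta> p) (Ns H \<delta> p \<inter> Rs H \<delta> (p + 1)) \<and>
      quotient_finite_dim smul (Rs H \<delta> (p + 1)) (Ns H \<delta> p \<inter> Rs H \<delta> (p + 1)))"

definition chain_index ::
  "('k::real_or_complex \<Rightarrow> 'a::{real_inner, complete_space} \<Rightarrow> 'a) \<Rightarrow> nat \<Rightarrow>
    (int \<Rightarrow> 'a set) \<Rightarrow> (int \<Rightarrow> 'a \<Rightarrow> 'a) \<Rightarrow> int"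
  where "chain_index smul n H \<delta> =
    (\<Sum>p\<in>{0..int n}. (-1) ^ nat p *
      (int (quotient_dim smul (Ns H \<delta> p) (Ns H \<delta> p \<inter> Rs H \<delta> (p + 1)))
       - int (quotient_dim smul (Rs H \<delta> (p + 1)) (Ns H \<delta> p \<inter> Rs H \<delta> (p + 1)))))"

end

theory Submission
  imports Defs
begin

text \<open>
  The proof is an induction on the length of the sequence that removes the top space.

  Let \<open>n\<close> be the length and suppose that \<open>H n\<close> has a closed subspace \<open>E\<close> of finite codimension \<open>l\<close>
  on which \<open>\<delta> n\<close> is injective, and that \<open>H (n - 1)\<close> is the direct sum of \<open>\<delta> n ` E\<close> and a closed
  subspace \<open>K\<close>. If \<open>\<delta> (n - 1)\<close> has finite rank on \<open>\<delta> n ` E\<close>, then up to finite dimensions the part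
  \<open>E \<rightarrow> \<delta> n ` E\<close> is an exact direct summand of the sequence. Hence the sequence with \<open>H n\<close> replaced
  by \<open>0\<close> and \<open>H (n - 1)\<close> replaced by \<open>K\<close>, with the same operators, is Fredholm if and only if the
  given one is, and the indices differ by \<open>(-1)^n * l\<close> (lemma \<open>reduce_sequence\<close>). The correction
  depends on \<open>E\<close> alone. So if one pair \<open>E\<close>, \<open>K\<close> serves both \<open>\<delta>\<close> and the perturbed operators, both
  indices change by the same amount and the induction hypothesis applies to the shorter sequence.
  A sequence of length \<open>0\<close> has only zero operators, and nothing can change there.

  That such a pair exists for \<open>\<delta>\<close> and survives small perturbations is lemma \<open>stable_splitting\<close>.
  For a Fredholm chain one takes \<open>E\<close> to be the orthogonal complement of \<open>N(\<delta> n)\<close> in the preimage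
  of \<open>N(\<delta> (n - 1))\<close>, so that \<open>\<delta> n ` E\<close> is \<open>N(\<delta> (n - 1)) \<inter> R(\<delta> n)\<close>, and \<open>K\<close> to be the sum of the
  orthogonal complement of \<open>N(\<delta> (n - 1))\<close> and a finite dimensional complement of \<open>\<delta> n ` E\<close> in
  \<open>N(\<delta> (n - 1))\<close>. Then \<open>(e, k) \<mapsto> \<delta> n e + k\<close> is a bounded bijection of the Hilbert spaces \<open>E \<times> K\<close>
  and \<open>H (n - 1)\<close>, and by the open mapping theorem every sufficiently close bounded operator is
  bijective too (lemmas \<open>bijection_stable\<close> and \<open>direct_sum_stable\<close>).

  For the bookkeeping, each term of the index is the relative dimension of two commensurable
  subspaces, which is additive: \<open>[A : C] = [A : B] + [B : C]\<close>.
\<close>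

section \<open>Subspaces of finite codimension\<close>

text \<open>The qualifier \<open>vs\<close> distinguishes the subspaces over the scalar field of the locale from the
real subspaces.\<close>

locale linear_algebra = vs: vector_space smul
  for smul :: "'k::field \<Rightarrow> 'b::ab_group_add \<Rightarrow> 'b" (infixr \<open>\<odot>\<close> 75)
begin

text \<open>Operators are total functions of which only the values on their domain matter; so linearity is
relative to a subspace.\<close>

definition linear_on :: "'b set \<Rightarrow> ('b \<Rightarrow> 'b) \<Rightarrow> bool"
  where "linear_on A f \<longleftrightarrow> vs.subspace A \<and> (\<forall>x\<in>A. \<forall>y\<in>A. f (x + y) = f x + f y) \<and>
    (\<forall>c. \<forall>x\<in>A. f (c \<odot> x) = c \<odot> f x)"

lemma linear_on_subset: "linear_on A f \<Longrightarrow> vs.subspace V \<Longrightarrow> V \<subseteq> A \<Longrightarrow> linear_on V f"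
  by (simp add: linear_on_def subset_iff)

lemma linear_on_id: "vs.subspace A \<Longrightarrow> linear_on A (\<lambda>x. x)"
  by (simp add: linear_on_def)

lemma linear_on_add: "linear_on A f \<Longrightarrow> x \<in> A \<Longrightarrow> y \<in> A \<Longrightarrow> f (x + y) = f x + f y"
  and linear_on_scale: "linear_on A f \<Longrightarrow> x \<in> A \<Longrightarrow> f (c \<odot> x) = c \<odot> f x"
  and linear_on_subspace: "linear_on A f \<Longrightarrow> vs.subspace A"
  by (auto simp: linear_on_def)

lemma linear_on_zero: "linear_on A f \<Longrightarrow> f 0 = 0"
  using linear_on_scale[of A f 0 0] linear_on_subspace[of A f] vs.subspace_0 by fastforce

lemma linear_on_diff:
  assumes "linear_on A f" "x \<in> A" "y \<in> A" shows "f (x - y) = f x - f y"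
proof -
  have "x - y \<in> A" using assms linear_on_subspace vs.subspace_diff by blast
  then have "f (x - y) + f y = f x" using linear_on_add[OF assms(1), of "x - y" y] assms(3) by simp
  then show ?thesis by (simp add: algebra_simps)
qed

lemma subspace_image_on:
  assumes "linear_on A f" "vs.subspace V" "V \<subseteq> A" shows "vs.subspace (f ` V)"
proof (rule vs.subspaceI)
  show "0 \<in> f ` V" using linear_on_zero[OF assms(1)] vs.subspace_0[OF assms(2)] by force
next
  fix x y assume "x \<in> f ` V" "y \<in> f ` V"
  then obtain a b where "a \<in> V" "b \<in> V" "x = f a" "y = f b" by blast
  then have "x + y = f (a + b)" "a + b \<in> V"
    using linear_on_add[OF assms(1)] assms(3) vs.subspace_add[OF assms(2)] by (auto simp: subset_iff)
  then show "x + y \<in> f ` V" by blast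
next
  fix c x assume "x \<in> f ` V"
  then obtain a where "a \<in> V" "x = f a" by blast
  then have "c \<odot> x = f (c \<odot> a)" "c \<odot> a \<in> V"
    using linear_on_scale[OF assms(1)] assms(3) vs.subspace_scale[OF assms(2)] by (auto simp: subset_iff)
  then show "c \<odot> x \<in> f ` V" by blast
qed

lemma subspace_preimage_on:
  assumes "linear_on A f" "vs.subspace V" "V \<subseteq> A" "vs.subspace X" shows "vs.subspace {x \<in> V. f x \<in> X}"
proof (rule vs.subspaceI)
  show "0 \<in> {x \<in> V. f x \<in> X}"
    using linear_on_zero[OF assms(1)] vs.subspace_0[OF assms(2)] vs.subspace_0[OF assms(4)] by simp
next
  fix x y assume xy: "x \<in> {x \<in> V. f x \<in> X}" "y \<in> {x \<in> V. f x \<in> X}"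
  then have "f (x + y) = f x + f y" using linear_on_add[OF assms(1)] assms(3) by auto
  then show "x + y \<in> {x \<in> V. f x \<in> X}"
    using xy vs.subspace_add[OF assms(2)] vs.subspace_add[OF assms(4)] by simp
next
  fix c x assume x: "x \<in> {x \<in> V. f x \<in> X}"
  then have "f (c \<odot> x) = c \<odot> f x" using linear_on_scale[OF assms(1)] assms(3) by auto
  then show "c \<odot> x \<in> {x \<in> V. f x \<in> X}"
    using x vs.subspace_scale[OF assms(2)] vs.subspace_scale[OF assms(4)] by simp
qed

lemma subspace_plus: "vs.subspace V \<Longrightarrow> vs.subspace W \<Longrightarrow> vs.subspace (V + W)"
proof -
  have "V + W = {x + y | x y. x \<in> V \<and> y \<in> W}" by (auto simp: set_plus_def)
  then show "vs.subspace V \<Longrightarrow> vs.subspace W \<Longrightarrow> vs.subspace (V + W)"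
    by (simp add: vs.subspace_sums)
qed

lemma subset_plus:
  assumes "vs.subspace V" "vs.subspace W" shows "V \<subseteq> V + W" "W \<subseteq> V + W"
proof -
  show "V \<subseteq> V + W"
  proof
    fix x assume "x \<in> V"
    then show "x \<in> V + W" using set_plus_intro[of x V 0 W] vs.subspace_0[OF assms(2)] by simp
  qed
  show "W \<subseteq> V + W"
  proof
    fix x assume "x \<in> W"
    then show "x \<in> V + W" using set_plus_intro[of 0 V x W] vs.subspace_0[OF assms(1)] by simp
  qed
qed

lemma plus_absorb:
  assumes "vs.subspace V" "vs.subspace W" "V \<subseteq> W" shows "V + W = W" and "W + V = W"
proof -
  show "V + W = W"
  proof
    show "V + W \<subseteq> W"
    proof
      fix x assume "x \<in> V + W"
      then obtain a b where "a \<in> V" "b \<in> W" "x = a + b" by (rule set_plus_elim)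
      then show "x \<in> W" using assms(3) vs.subspace_add[OF assms(2)] by blast
    qed
  qed (rule subset_plus(2)[OF assms(1,2)])
  then show "W + V = W" by (simp add: add.commute)
qed

lemma mem_span_insert:
  assumes "vs.subspace W" shows "x \<in> vs.span (insert v W) \<longleftrightarrow> (\<exists>k. x - k \<odot> v \<in> W)"
proof -
  have "vs.span W = W" using assms by (simp only: vs.span_eq_iff)
  then show ?thesis by (simp only: vs.span_breakdown_eq)
qed

lemma span_insertE:
  assumes "vs.subspace W" "x \<in> vs.span (insert v W)"
  obtains w k where "w \<in> W" "x = w + k \<odot> v"
proof -
  obtain k where "x - k \<odot> v \<in> W" using assms mem_span_insert by blast
  then show thesis using that[of "x - k \<odot> v" k] by simp
qed

lemma span_insertI:
  "vs.subspace W \<Longrightarrow> w \<in> W \<Longrightarrow> w + k \<odot> v \<in> vs.span (insert v W)"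
  by (subst mem_span_insert) (auto intro!: exI[of _ k])

lemma span_insert_subset: "vs.subspace A \<Longrightarrow> W \<subseteq> A \<Longrightarrow> v \<in> A \<Longrightarrow> vs.span (insert v W) \<subseteq> A"
  by (simp add: vs.span_minimal)

text \<open>\<open>has_codim V W d\<close> says that \<open>W\<close> is a subspace of \<open>V\<close> of codimension \<open>d\<close>. It is defined by
adjoining one vector at a time, because statements about images, preimages, sums and
intersections need then only be checked for a single additional vector.\<close>

inductive has_codim :: "'b set \<Rightarrow> 'b set \<Rightarrow> nat \<Rightarrow> bool" where
  same: "vs.subspace W \<Longrightarrow> has_codim W W 0"
| step: "vs.subspace W \<Longrightarrow> v \<notin> W \<Longrightarrow> has_codim V (vs.span (insert v W)) d \<Longrightarrow> has_codim V W (Suc d)"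

lemma has_codim_subspace:
  assumes "has_codim V W d" shows "vs.subspace V" "vs.subspace W" "W \<subseteq> V"
  using assms by (induction) (auto intro: vs.span_base)

lemma has_codim_0: "has_codim V W 0 \<longleftrightarrow> V = W \<and> vs.subspace W"
  by (auto elim: has_codim.cases intro: has_codim.same)

lemma has_codim_trans: "has_codim U V a \<Longrightarrow> has_codim V W b \<Longrightarrow> has_codim U W (a + b)"
  by (rotate_tac 1, induction rule: has_codim.induct) (auto intro: has_codim.step)

lemma has_codim_line:
  assumes "vs.subspace W" "v \<notin> W" shows "has_codim (vs.span (insert v W)) W 1"
  using has_codim.step[OF assms has_codim.same] by simp

text \<open>A line that is added to \<open>W\<close> shows up exactly once: in the image modulo \<open>X\<close> if \<open>f v\<close> is new
there, and otherwise in the preimage of \<open>X\<close>, since \<open>v\<close> can then be corrected by an element of \<open>W\<close>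
so that \<open>f\<close> maps it into \<open>X\<close>.\<close>

lemma image_preimage_line:
  assumes f: "linear_on A f" and W: "vs.subspace W" "W \<subseteq> A" and v: "v \<in> A" "v \<notin> W" and X: "vs.subspace X"
  defines "U \<equiv> vs.span (insert v W)"
  obtains a b where "has_codim (f ` U + X) (f ` W + X) a"
    "has_codim {x \<in> U. f x \<in> X} {x \<in> W. f x \<in> X} b" "a + b = 1"
proof -
  have U: "vs.subspace U" "U \<subseteq> A"
    using span_insert_subset[OF linear_on_subspace[OF f] W(2) v(1)] by (auto simp: U_def)
  have fW: "vs.subspace (f ` W + X)" using subspace_plus[OF subspace_image_on[OF f W] X] .
  have pW: "vs.subspace {x \<in> W. f x \<in> X}" by (rule subspace_preimage_on[OF f W X])
  note lin = linear_on_add[OF f] linear_on_scale[OF f] linear_on_diff[OF f]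
    vs.subspace_scale[OF linear_on_subspace[OF f]]
  show thesis
  proof (cases "f v \<in> f ` W + X")
    case False
    have "f ` U + X = vs.span (insert (f v) (f ` W + X))"
    proof (intro equalityI subsetI)
      fix y assume "y \<in> f ` U + X"
      then obtain u x where y: "u \<in> U" "x \<in> X" "y = f u + x" by (auto elim!: set_plus_elim)
      obtain w k where w: "w \<in> W" "u = w + k \<odot> v" by (rule span_insertE[OF W(1) y(1)[unfolded U_def]])
      then have "y = (f w + x) + k \<odot> f v" using y v W lin by (auto simp: algebra_simps subset_iff)
      moreover have "f w + x \<in> f ` W + X" using w y by (auto intro: set_plus_intro)
      ultimately show "y \<in> vs.span (insert (f v) (f ` W + X))" using span_insertI[OF fW, of "f w + x" k "f v"] by simp
    next
      fix y assume "y \<in> vs.span (insert (f v) (f ` W + X))"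
      then obtain z k where z: "z \<in> f ` W + X" "y = z + k \<odot> f v" by (rule span_insertE[OF fW])
      then obtain w x where w: "w \<in> W" "x \<in> X" "z = f w + x" by (auto elim!: set_plus_elim)
      have "y = f (w + k \<odot> v) + x" using z w v W lin by (auto simp: algebra_simps subset_iff)
      moreover have "w + k \<odot> v \<in> U" unfolding U_def by (rule span_insertI[OF W(1) w(1)])
      ultimately show "y \<in> f ` U + X" using w by (auto intro: set_plus_intro)
    qed
    then have 1: "has_codim (f ` U + X) (f ` W + X) 1" using has_codim_line[OF fW False] by simp
    have "{x \<in> U. f x \<in> X} = {x \<in> W. f x \<in> X}"
    proof (intro equalityI subsetI; clarsimp)
      fix u assume u: "u \<in> U" "f u \<in> X"
      obtain w k where w: "w \<in> W" "u = w + k \<odot> v" by (rule span_insertE[OF W(1) u(1)[unfolded U_def]])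
      have "k = 0"
      proof (rule ccontr)
        assume k: "k \<noteq> 0"
        have "f u = f w + k \<odot> f v" using w v W lin by (auto simp: subset_iff)
        then have "f v = inverse k \<odot> (f u - f w)" using k by (simp add: vs.scale_right_diff_distrib)
        also have "\<dots> = f (- (inverse k \<odot> w)) + inverse k \<odot> f u"
        proof -
          have "f (- (inverse k \<odot> w)) = - (inverse k \<odot> f w)"
            using lin(2)[of w "- inverse k"] w W by (auto simp: subset_iff)
          then show ?thesis by (simp add: vs.scale_right_diff_distrib)
        qed
        also have "\<dots> \<in> f ` W + X"
          using w u W X by (intro set_plus_intro imageI) (auto intro: vs.subspace_scale vs.subspace_neg)
        finally show False using False by simp
      qed
      then show "u \<in> W" using w by simp
    next
      fix u assume "u \<in> W" then show "u \<in> U" by (simp add: U_def vs.span_base)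
    qed
    then have "has_codim {x \<in> U. f x \<in> X} {x \<in> W. f x \<in> X} 0" using pW by (simp add: has_codim_0)
    with 1 that show thesis by auto
  next
    case True
    then obtain w0 x0 where w0: "w0 \<in> W" "x0 \<in> X" "f v = f w0 + x0" by (auto elim!: set_plus_elim)
    define u where "u = v - w0"
    have fu: "f u = x0" using lin(3)[of v w0] w0 v W by (auto simp: u_def subset_iff)
    have uW: "u \<notin> W" using vs.subspace_add[OF W(1), of u w0] w0 v by (auto simp: u_def)
    have uA: "u \<in> A" using w0 W v vs.subspace_diff[OF linear_on_subspace[OF f]] by (auto simp: u_def)
    have Ueq: "U = vs.span (insert u W)"
      unfolding U_def u_def
      by (rule vs.eq_span_insert_eq) (simp add: vs.span_base w0(1))
    have "f ` U + X = f ` W + X"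
    proof (intro equalityI subsetI)
      fix y assume "y \<in> f ` U + X"
      then obtain u' x where y: "u' \<in> U" "x \<in> X" "y = f u' + x" by (auto elim!: set_plus_elim)
      obtain w k where w: "w \<in> W" "u' = w + k \<odot> u" by (rule span_insertE[OF W(1) y(1)[unfolded Ueq]])
      have "f u' = f w + k \<odot> x0" using w uA W lin fu by (auto simp: subset_iff)
      then have "y = f w + (k \<odot> x0 + x)" using y w by (simp add: algebra_simps)
      moreover have "k \<odot> x0 + x \<in> X" using y w0 X vs.subspace_add vs.subspace_scale by blast
      ultimately show "y \<in> f ` W + X" using w by (auto intro: set_plus_intro)
    next
      fix y assume "y \<in> f ` W + X"
      moreover have "W \<subseteq> U" by (auto simp: U_def vs.span_base)
      ultimately show "y \<in> f ` U + X" using set_plus_mono2[OF image_mono order.refl] by blast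
    qed
    then have 1: "has_codim (f ` U + X) (f ` W + X) 0" using fW by (simp add: has_codim_0)
    have "{x \<in> U. f x \<in> X} = vs.span (insert u {x \<in> W. f x \<in> X})"
    proof (intro equalityI subsetI)
      fix y assume "y \<in> {x \<in> U. f x \<in> X}"
      then have y: "y \<in> U" "f y \<in> X" by auto
      obtain w k where w: "w \<in> W" "y = w + k \<odot> u" by (rule span_insertE[OF W(1) y(1)[unfolded Ueq]])
      have "f w = f y - k \<odot> x0" using w uA W lin fu by (auto simp: subset_iff)
      then have "f w \<in> X" using y w0 X by (simp add: vs.subspace_diff vs.subspace_scale)
      then show "y \<in> vs.span (insert u {x \<in> W. f x \<in> X})" using w span_insertI[OF pW, of w k u] by simp
    next
      fix y assume "y \<in> vs.span (insert u {x \<in> W. f x \<in> X})"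
      then obtain w k where w: "w \<in> {x \<in> W. f x \<in> X}" "y = w + k \<odot> u" by (rule span_insertE[OF pW])
      have "f y = f w + k \<odot> x0" using w uA W lin fu by (auto simp: subset_iff)
      then show "y \<in> {x \<in> U. f x \<in> X}" using w w0 X span_insertI[OF W(1), of w k u] Ueq
        by (simp add: vs.subspace_add vs.subspace_scale)
    qed
    then have "has_codim {x \<in> U. f x \<in> X} {x \<in> W. f x \<in> X} 1"
      using has_codim_line[OF pW] uW by simp
    with 1 that show thesis by auto
  qed
qed

text \<open>The choice \<open>X = {0}\<close> gives the dimension formula for kernel and image, and the identity map
gives the modular law for \<open>V + X\<close> and \<open>V \<inter> X\<close>. All later dimension counts come from these two.\<close>

lemma rank_nullity:
  assumes "has_codim V W d" "linear_on A f" "V \<subseteq> A" "vs.subspace X"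
  shows "\<exists>a b. has_codim (f ` V + X) (f ` W + X) a \<and>
    has_codim {x \<in> V. f x \<in> X} {x \<in> W. f x \<in> X} b \<and> d = a + b"
  using assms
proof (induction)
  case (same W)
  then show ?case using subspace_plus[OF subspace_image_on[OF same.prems(1) same.hyps same.prems(2)] same.prems(3)]
    subspace_preimage_on[OF same.prems(1) same.hyps same.prems(2,3)]
    by (intro exI[of _ 0]) (simp add: has_codim_0)
next
  case (step W v V d)
  have VA: "vs.span (insert v W) \<subseteq> V" using has_codim_subspace[OF step.hyps(3)] by simp
  have "insert v W \<subseteq> A" using order.trans[OF vs.span_superset order.trans[OF VA step.prems(2)]] .
  then have WA: "W \<subseteq> A" "v \<in> A" by auto
  from step.IH[OF step.prems] obtain a b where
    "has_codim (f ` V + X) (f ` vs.span (insert v W) + X) a \<and>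
     has_codim {x \<in> V. f x \<in> X} {x \<in> vs.span (insert v W). f x \<in> X} b \<and> d = a + b"
    by (elim exE)
  then have ab: "has_codim (f ` V + X) (f ` vs.span (insert v W) + X) a"
    "has_codim {x \<in> V. f x \<in> X} {x \<in> vs.span (insert v W). f x \<in> X} b" "d = a + b"
    by simp_all
  obtain a' b' where ab': "has_codim (f ` vs.span (insert v W) + X) (f ` W + X) a'"
    "has_codim {x \<in> vs.span (insert v W). f x \<in> X} {x \<in> W. f x \<in> X} b'" "a' + b' = 1"
    using image_preimage_line[OF step.prems(1) step.hyps(1) WA step.hyps(2) step.prems(3)] .
  show ?case
  proof (intro exI conjI)
    show "Suc d = (a + a') + (b + b')" using ab(3) ab'(3) by simp
  qed (rule has_codim_trans[OF ab(1) ab'(1)] has_codim_trans[OF ab(2) ab'(2)])+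
qed

lemma has_codim_modular:
  assumes "has_codim V W d" "vs.subspace X"
  obtains a b where "has_codim (V + X) (W + X) a" "has_codim (V \<inter> X) (W \<inter> X) b" "d = a + b"
proof -
  from rank_nullity[OF assms(1) linear_on_id[OF has_codim_subspace(1)[OF assms(1)]] order.refl assms(2)]
  obtain a b where "has_codim (V + X) (W + X) a \<and> has_codim (V \<inter> X) (W \<inter> X) b \<and> d = a + b"
    unfolding image_ident Int_def by (elim exE)
  then show thesis by (elim conjE) (rule that)
qed

lemma has_codim_image_kernel:
  assumes "has_codim V W d" "linear_on A f" "V \<subseteq> A"
  obtains a b where "has_codim (f ` V) (f ` W) a"
    "has_codim (ker_on V f) (ker_on W f) b" "d = a + b"
proof -
  have eq: "S + {0} = S" for S :: "'b set" by (auto simp: set_plus_def)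
  from rank_nullity[OF assms vs.subspace_single_0]
  obtain a b where "has_codim (f ` V) (f ` W) a \<and> has_codim (ker_on V f) (ker_on W f) b \<and> d = a + b"
    unfolding eq ker_on_def singleton_iff by (elim exE)
  then show thesis by (elim conjE) (rule that)
qed

lemma mem_span_insert_self: "v \<in> vs.span (insert v W)"
  by (rule vs.span_base[OF insertI1])

lemma subset_span_insert: "W \<subseteq> vs.span (insert v W)"
  by (rule order.trans[OF subset_insertI vs.span_superset])

lemma has_codim_self:
  assumes "has_codim W W d" shows "d = 0"
  using assms
proof (cases rule: has_codim.cases)
  case (step v d)
  then show ?thesis using has_codim_subspace(3)[OF step(4)] mem_span_insert_self[of v W] by auto
qed simp

text \<open>This is the exchange step: if \<open>u\<close> is the first vector that is adjoined to \<open>W\<close>, then \<open>u\<close> and \<open>v\<close>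
span the same line modulo \<open>W\<close>.\<close>

lemma has_codim_line_unique:
  assumes "has_codim (vs.span (insert v W)) W d" "v \<notin> W" shows "d = 1"
  using assms(1)
proof (cases rule: has_codim.cases)
  case same
  then show ?thesis using mem_span_insert_self[of v W] assms(2) by simp
next
  case (step u e)
  have "u \<in> vs.span (insert v W)"
    using has_codim_subspace(3)[OF step(4)] mem_span_insert_self[of u W] by (rule subsetD)
  then obtain w k where w: "w \<in> W" "u = w + k \<odot> v" by (rule span_insertE[OF step(2)])
  have k: "k \<noteq> 0"
  proof
    assume "k = 0"
    then show False using w step(3) by simp
  qed
  have "inverse k \<odot> u - inverse k \<odot> w = v" using k w by (simp add: vs.scale_right_distrib)
  moreover have "inverse k \<odot> u - inverse k \<odot> w \<in> vs.span (insert u W)"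
    by (intro vs.span_diff vs.span_scale vs.span_base insertI1 insertI2 w(1))
  ultimately have v: "v \<in> vs.span (insert u W)" by simp
  have "vs.span (insert v W) \<subseteq> vs.span (insert u W)"
    by (rule span_insert_subset[OF vs.subspace_span subset_span_insert v])
  then have eq: "vs.span (insert u W) = vs.span (insert v W)"
    using has_codim_subspace(3)[OF step(4)] by (intro equalityI)
  show ?thesis using has_codim_self[OF step(4)[unfolded eq]] step(1) by simp
qed

text \<open>Intersecting the second chain of subspaces with the first member above \<open>W\<close> of the first one
separates a single step from the rest, to which the induction hypothesis applies.\<close>

lemma has_codim_unique: "has_codim V W d \<Longrightarrow> has_codim V W d' \<Longrightarrow> d = d'"
proof (induction arbitrary: d' rule: has_codim.induct)
  case (same W)
  then show ?case using has_codim_self by simp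
next
  case (step W v V d)
  let ?U = "vs.span (insert v W)"
  note V = has_codim_subspace[OF step.hyps(3)]
  have WU: "W \<subseteq> ?U" by (rule subset_span_insert)
  obtain a b where ab: "has_codim (V + ?U) (W + ?U) a" "has_codim (V \<inter> ?U) (W \<inter> ?U) b" "d' = a + b"
    by (rule has_codim_modular[OF step.prems V(2)])
  have "has_codim V ?U a" using ab(1)
    unfolding plus_absorb(2)[OF V(2) V(1) V(3)] plus_absorb(1)[OF step.hyps(1) V(2) WU] .
  then have a: "d = a" by (rule step.IH)
  have "has_codim ?U W b" using ab(2) unfolding Int_absorb1[OF V(3)] Int_absorb2[OF WU] .
  then have "b = 1" by (rule has_codim_line_unique[OF _ step.hyps(2)])
  then show ?case using a ab(3) by simp
qed

lemma has_codim_between: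
  assumes "has_codim U W d" "vs.subspace V" "W \<subseteq> V" "V \<subseteq> U"
  obtains a b where "has_codim U V a" "has_codim V W b" "d = a + b"
proof -
  note U = has_codim_subspace[OF assms(1)]
  obtain a b where ab: "has_codim (U + V) (W + V) a" "has_codim (U \<inter> V) (W \<inter> V) b" "d = a + b"
    by (rule has_codim_modular[OF assms(1,2)])
  then show thesis using that assms plus_absorb(2)[OF assms(2) U(1) assms(4)] plus_absorb(1)[OF U(2) assms(2,3)]
    by (simp add: Int_absorb1 Int_absorb2)
qed

lemma has_codim_plus_iff:
  assumes V: "vs.subspace V" and W: "vs.subspace W"
  shows "has_codim (V + W) W d \<longleftrightarrow> has_codim V (V \<inter> W) d"
proof
  assume "has_codim (V + W) W d"
  from this V obtain a b where ab: "has_codim ((V + W) + V) (W + V) a" "has_codim ((V + W) \<inter> V) (W \<inter> V) b" "d = a + b"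
    by (rule has_codim_modular)
  have "(V + W) + V = W + V" using plus_absorb(2)[OF V subspace_plus[OF V W] subset_plus(1)[OF V W]]
    by (simp add: add.commute)
  then have "a = 0" using has_codim_unique[OF ab(1)] has_codim.same[OF subspace_plus[OF W V]] by simp
  moreover have "(V + W) \<inter> V = V" using subset_plus(1)[OF V W] by blast
  ultimately show "has_codim V (V \<inter> W) d" using ab by (simp add: Int_commute)
next
  assume "has_codim V (V \<inter> W) d"
  from this W obtain a b where ab: "has_codim (V + W) (V \<inter> W + W) a" "has_codim (V \<inter> W) (V \<inter> W \<inter> W) b" "d = a + b"
    by (rule has_codim_modular)
  have "b = 0" using has_codim_unique[OF ab(2)[unfolded inf.right_idem] has_codim.same[OF vs.subspace_inter[OF V W]]] .
  then show "has_codim (V + W) W d" using ab plus_absorb(1)[OF vs.subspace_inter[OF V W] W] by simp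
qed

lemma has_codim_preimage:
  assumes "has_codim Y Z d" "linear_on A f" "Y \<subseteq> f ` A"
  shows "has_codim {x \<in> A. f x \<in> Y} {x \<in> A. f x \<in> Z} d"
  using assms
proof (induction rule: has_codim.induct)
  case (same W)
  then show ?case using subspace_preimage_on[OF _ linear_on_subspace order.refl] has_codim.same by blast
next
  case (step W v V d)
  note f = \<open>linear_on A f\<close>
  have "v \<in> V" using has_codim_subspace(3)[OF step.hyps(3)] vs.span_superset by blast
  then obtain u where u: "u \<in> A" "f u = v" using step.prems by blast
  let ?P = "{x \<in> A. f x \<in> W}"
  have P: "vs.subspace ?P" using subspace_preimage_on[OF f linear_on_subspace[OF f] order.refl step.hyps(1)] .
  have "{x \<in> A. f x \<in> vs.span (insert v W)} = vs.span (insert u ?P)"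
  proof (intro equalityI subsetI)
    fix x assume "x \<in> {x \<in> A. f x \<in> vs.span (insert v W)}"
    then obtain k where k: "x \<in> A" "f x - k \<odot> v \<in> W" using mem_span_insert step.hyps(1) by blast
    have "k \<odot> u \<in> A" using u vs.subspace_scale[OF linear_on_subspace[OF f]] by blast
    then have "x - k \<odot> u \<in> ?P" using k u linear_on_diff[OF f] linear_on_scale[OF f]
      vs.subspace_diff[OF linear_on_subspace[OF f]] by simp
    then show "x \<in> vs.span (insert u ?P)" using mem_span_insert[OF P] by blast
  next
    fix x assume "x \<in> vs.span (insert u ?P)"
    then obtain w k where w: "w \<in> A" "f w \<in> W" "x = w + k \<odot> u" by (rule span_insertE[OF P]) blast
    have "k \<odot> u \<in> A" using u vs.subspace_scale[OF linear_on_subspace[OF f]] by blast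
    then show "x \<in> {x \<in> A. f x \<in> vs.span (insert v W)}"
      using w u linear_on_add[OF f] linear_on_scale[OF f] vs.subspace_add[OF linear_on_subspace[OF f]]
        span_insertI[OF step.hyps(1) w(2)] by simp
  qed
  then show ?case using step P u by (intro has_codim.step[of _ u]) auto
qed

lemma has_codim_complement:
  "has_codim V W d \<Longrightarrow> \<exists>G. has_codim G {0} d \<and> G \<inter> W = {0} \<and> G + W = V"
proof (induction rule: has_codim.induct)
  case (same W)
  then show ?case using plus_absorb(1)[of "{0}" W] vs.subspace_0
    by (intro exI[of _ "{0}"]) (auto intro: has_codim.same)
next
  case (step W v V d)
  then obtain G where G: "has_codim G {0} d" "G \<inter> vs.span (insert v W) = {0}" "G + vs.span (insert v W) = V"
    by blast
  note sG = has_codim_subspace(1)[OF G(1)]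
  have "v \<noteq> 0" using step.hyps vs.subspace_0 by auto
  have vG: "v \<notin> G" using G(2) \<open>v \<noteq> 0\<close> vs.span_base[of v "insert v W"] by auto
  let ?G = "vs.span (insert v G)"
  have "has_codim ?G {0} (Suc d)" using has_codim_trans[OF has_codim_line[OF sG vG] G(1)] by simp
  moreover have "x = 0" if x: "x \<in> ?G" "x \<in> W" for x
  proof -
    obtain g k where g: "g \<in> G" "x = g + k \<odot> v" by (rule span_insertE[OF sG x(1)])
    then have "g = x + (- k) \<odot> v" by simp
    then have "g \<in> vs.span (insert v W)" using span_insertI[OF step.hyps(1) x(2), of "-k" v] by simp
    then have "g = 0" using G(2) g by blast
    then have xk: "x = k \<odot> v" using g by simp
    have "k = 0"
    proof (rule ccontr)
      assume "k \<noteq> 0"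
      then have "v = inverse k \<odot> x" using xk by simp
      then show False using vs.subspace_scale[OF step.hyps(1) x(2)] step.hyps(2) by simp
    qed
    then show "x = 0" using xk by simp
  qed
  then have "?G \<inter> W = {0}" using vs.subspace_0[OF step.hyps(1)] vs.span_zero by auto
  moreover have "?G + W = V"
    unfolding G(3)[symmetric]
  proof (intro equalityI subsetI)
    fix x assume "x \<in> ?G + W"
    then obtain h w where h: "h \<in> ?G" "w \<in> W" "x = h + w" by (auto elim!: set_plus_elim)
    obtain g k where "g \<in> G" "h = g + k \<odot> v" by (rule span_insertE[OF sG h(1)])
    with h have "g \<in> G" "w \<in> W" "x = g + (w + k \<odot> v)" by (auto simp: algebra_simps)
    then show "x \<in> G + vs.span (insert v W)" using span_insertI[OF step.hyps(1)]
      by (simp add: set_plus_intro)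
  next
    fix x assume "x \<in> G + vs.span (insert v W)"
    then obtain g h where h: "g \<in> G" "h \<in> vs.span (insert v W)" "x = g + h" by (auto elim!: set_plus_elim)
    obtain w k where "w \<in> W" "h = w + k \<odot> v" by (rule span_insertE[OF step.hyps(1) h(2)])
    with h have "g \<in> G" "w \<in> W" "x = (g + k \<odot> v) + w" by (auto simp: algebra_simps)
    then show "x \<in> ?G + W" using span_insertI[OF sG]
      by (simp add: set_plus_intro)
  qed
  ultimately show ?case by blast
qed

section \<open>Commensurable subspaces and their relative dimension\<close>

text \<open>\<open>commensurable A B i\<close> says that \<open>A\<close> and \<open>B\<close> have a common subspace of finite codimension and
that \<open>i\<close> is their relative dimension \<open>dim A/D - dim B/D\<close>. The subspace \<open>D\<close> is left open, because
with \<open>D = A \<inter> B\<close> fixed transitivity would be awkward to prove.\<close>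

definition commensurable :: "'b set \<Rightarrow> 'b set \<Rightarrow> int \<Rightarrow> bool"
  where "commensurable A B i \<longleftrightarrow>
    (\<exists>D a b. has_codim A D a \<and> has_codim B D b \<and> i = int a - int b)"

lemma commensurableI: "has_codim A D a \<Longrightarrow> has_codim B D b \<Longrightarrow> i = int a - int b \<Longrightarrow> commensurable A B i"
  unfolding commensurable_def by (intro exI conjI)

lemma commensurableE:
  assumes "commensurable A B i"
  obtains D a b where "has_codim A D a" "has_codim B D b" "i = int a - int b"
  using assms unfolding commensurable_def by (elim exE conjE)

lemma commensurable_subspace:
  assumes "commensurable A B i" shows "vs.subspace A" "vs.subspace B"
  using assms by (auto elim!: commensurableE dest: has_codim_subspace)

lemma commensurable_sym: "commensurable A B i \<Longrightarrow> commensurable B A (- i)"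
  by (erule commensurableE) (rule commensurableI, assumption+, simp)

lemma commensurable_codim: "has_codim V W d \<Longrightarrow> commensurable V W (int d)"
  by (rule commensurableI[OF _ has_codim.same]) (auto dest: has_codim_subspace)

text \<open>The two common subspaces \<open>D\<close> and \<open>D'\<close> lie in \<open>B\<close> with finite codimension, hence so does
\<open>D \<inter> D'\<close>, and relative to \<open>D \<inter> D'\<close> the contributions of \<open>B\<close> cancel.\<close>

lemma commensurable_trans:
  assumes "commensurable A B i" "commensurable B C j" shows "commensurable A C (i + j)"
proof -
  obtain D a b where 1: "has_codim A D a" "has_codim B D b" "i = int a - int b"
    using assms(1) by (rule commensurableE)
  obtain D' b' c where 2: "has_codim B D' b'" "has_codim C D' c" "j = int b' - int c"
    using assms(2) by (rule commensurableE)
  note D = has_codim_subspace[OF 1(2)] and D' = has_codim_subspace[OF 2(1)]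
  obtain x where x: "has_codim D (D' \<inter> D) x"
    using has_codim_modular[OF 2(1) D(2)] unfolding Int_absorb1[OF D(3)] .
  obtain y where y: "has_codim D' (D \<inter> D') y"
    using has_codim_modular[OF 1(2) D'(2)] unfolding Int_absorb1[OF D'(3)] .
  have "b + x = b' + y"
    using has_codim_unique[OF has_codim_trans[OF 1(2) x[unfolded Int_commute[of D' D]]] has_codim_trans[OF 2(1) y]] .
  then have "i + j = int (a + x) - int (c + y)" using 1(3) 2(3) by simp
  then show ?thesis
    by (rule commensurableI[OF has_codim_trans[OF 1(1) x[unfolded Int_commute[of D' D]]] has_codim_trans[OF 2(2) y]])
qed

lemma commensurable_unique:
  assumes "commensurable A B i" "commensurable A B j" shows "i = j"
proof -
  have "commensurable A A (i + - j)"
    using commensurable_trans[OF assms(1) commensurable_sym[OF assms(2)]] .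
  then obtain D a b where "has_codim A D a" "has_codim A D b" "i + - j = int a - int b"
    by (rule commensurableE)
  then show ?thesis using has_codim_unique by fastforce
qed

lemma commensurable_nested:
  assumes "commensurable V W i" "W \<subseteq> V"
  obtains d where "has_codim V W d" "i = int d"
proof -
  obtain D a b where D: "has_codim V D a" "has_codim W D b" "i = int a - int b"
    using assms(1) by (rule commensurableE)
  note W = has_codim_subspace[OF D(2)]
  obtain d e where "has_codim V W d" "has_codim W D e" "a = d + e"
    by (rule has_codim_between[OF D(1) W(1,3) assms(2)])
  moreover from this have "i = int d" using has_codim_unique[OF D(2)] D(3) by simp
  ultimately show thesis using that by blast
qed

lemma commensurable_Int:
  assumes "commensurable A B i"
  obtains a b where "has_codim A (A \<inter> B) a" "has_codim B (A \<inter> B) b" "i = int a - int b"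
proof -
  obtain D a b where D: "has_codim A D a" "has_codim B D b" "i = int a - int b"
    using assms by (rule commensurableE)
  note A = has_codim_subspace[OF D(1)] and B = has_codim_subspace[OF D(2)]
  have I: "vs.subspace (A \<inter> B)" "D \<subseteq> A \<inter> B" using vs.subspace_inter A B by auto
  obtain x y where x: "has_codim A (A \<inter> B) x" "has_codim (A \<inter> B) D y" "a = x + y"
    by (rule has_codim_between[OF D(1) I Int_lower1])
  obtain z w where z: "has_codim B (A \<inter> B) z" "has_codim (A \<inter> B) D w" "b = z + w"
    by (rule has_codim_between[OF D(2) I Int_lower2])
  have "i = int x - int z" using has_codim_unique[OF x(2) z(2)] D(3) x(3) z(3) by simp
  with x(1) z(1) show thesis by (rule that)
qed

lemma commensurable_right_iff:
  assumes "commensurable B C j"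
  shows "commensurable A B i \<longleftrightarrow> commensurable A C (i + j)"
  using commensurable_trans[of A B i C j] commensurable_trans[of A C "i + j" B "- j"]
    assms commensurable_sym[OF assms] by auto

section \<open>Splitting off the image of a subspace\<close>

lemma kernel_codim:
  assumes f: "linear_on A f" and r: "has_codim (f ` A) {0} r"
  shows "has_codim A (ker_on A f) r"
proof -
  have "{x \<in> A. f x \<in> f ` A} = A" by blast
  then show ?thesis using has_codim_preimage[OF r f order.refl] by (simp add: ker_on_def)
qed

lemma subspace_kernel: "linear_on A f \<Longrightarrow> vs.subspace (ker_on A f)"
  using subspace_preimage_on[of A f A "{0}"] linear_on_subspace[of A f] by (simp add: ker_on_def)

text \<open>Both sides compare with the space \<open>K0\<close> of those \<open>k \<in> K\<close> for which \<open>f k \<in> f ` B\<close>. On the one hand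
\<open>N + B = B \<oplus> K0\<close> for the kernel \<open>N\<close> of \<open>f\<close> on \<open>A\<close>, so \<open>N/(N \<inter> B)\<close> and \<open>K0\<close> have the same
dimension. On the other hand \<open>f\<close> maps \<open>K0\<close> onto \<open>f ` B \<inter> f ` K\<close>, with the kernel of \<open>f\<close> on \<open>K\<close>.\<close>

lemma kernel_commensurable_split:
  assumes f: "linear_on A f" and B: "vs.subspace B" and K: "vs.subspace K"
    and A: "B + K = A" "B \<inter> K = {0}"
    and r: "has_codim (f ` B) {0} r" and e: "has_codim (f ` B) (f ` B \<inter> f ` K) e"
  shows "commensurable (ker_on A f) B j \<longleftrightarrow> commensurable (ker_on K f) {0} (j + int e)"
proof -
  define N where "N = ker_on A f"
  have sub: "B \<subseteq> A" "K \<subseteq> A" using subset_plus[OF B K] A(1) by auto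
  have N: "vs.subspace N" "N \<subseteq> A" using subspace_kernel[OF f] by (auto simp: N_def ker_on_def)
  have Nf: "x \<in> N \<longleftrightarrow> x \<in> A \<and> f x = 0" for x by (auto simp: N_def ker_on_def)
  have NK: "ker_on K f = N \<inter> K" using sub by (auto simp: Nf ker_on_def)
  have "ker_on B f = N \<inter> B" using sub by (auto simp: Nf ker_on_def)
  then have r': "has_codim B (N \<inter> B) r"
    using kernel_codim[OF linear_on_subset[OF f B sub(1)] r] by simp
  \<comment> \<open>Equivalently, the elements of \<open>K\<close> that \<open>f\<close> maps into \<open>f ` B\<close>.\<close>
  define K0 where "K0 = (N + B) \<inter> K"
  have NB: "vs.subspace (N + B)" by (rule subspace_plus[OF N(1) B])
  have K0: "vs.subspace K0" unfolding K0_def by (rule vs.subspace_inter[OF NB K])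
  have K0A: "K0 \<subseteq> A" using sub(2) by (auto simp: K0_def)
  have K0B: "K0 \<inter> B = {0}" using A(2) vs.subspace_0[OF K0] vs.subspace_0[OF B] by (auto simp: K0_def)
  have split: "K0 + B = N + B"
  proof (intro equalityI subsetI)
    fix x assume "x \<in> K0 + B"
    then obtain k b where "k \<in> N + B" "b \<in> B" "x = k + b" by (auto simp: K0_def elim!: set_plus_elim)
    moreover from this have "b \<in> N + B" using subset_plus(2)[OF N(1) B] by blast
    ultimately show "x \<in> N + B" using vs.subspace_add[OF NB] by simp
  next
    fix x assume x: "x \<in> N + B"
    then obtain n b where n: "n \<in> N" "b \<in> B" "x = n + b" by (rule set_plus_elim)
    then have "n \<in> B + K" using N(2) A(1) by blast
    then obtain b' k where k: "b' \<in> B" "k \<in> K" "n = b' + k" by (rule set_plus_elim)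
    have "k = n + (- b')" using k by simp
    then have "k \<in> N + B" using set_plus_intro[OF n(1) vs.subspace_neg[OF B k(1)]] by simp
    then have "k \<in> K0" using k by (simp add: K0_def)
    then show "x \<in> K0 + B" using set_plus_intro[OF _ vs.subspace_add[OF B k(1) n(2)], of k K0] n k
      by (simp add: algebra_simps)
  qed
  have fK0: "f ` K0 = f ` B \<inter> f ` K"
  proof (intro equalityI subsetI)
    fix y assume "y \<in> f ` K0"
    then obtain n b where *: "n \<in> N" "b \<in> B" "n + b \<in> K" "y = f (n + b)"
      by (auto simp: K0_def elim!: set_plus_elim)
    then have "y = f b" using linear_on_add[OF f, of n b] Nf sub(1) by auto
    then show "y \<in> f ` B \<inter> f ` K" using * by blast
  next
    fix y assume "y \<in> f ` B \<inter> f ` K"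
    then obtain b k where *: "b \<in> B" "k \<in> K" "y = f k" "f k = f b" by auto
    then have "k - b \<in> N" using linear_on_diff[OF f, of k b] Nf sub vs.subspace_diff[OF linear_on_subspace[OF f], of k b]
      by auto
    then have "k \<in> N + B" using set_plus_intro[of "k - b" N b B] * by simp
    then have "k \<in> K0" using * by (simp add: K0_def)
    then show "y \<in> f ` K0" using *(3) by blast
  qed
  have "ker_on K f \<subseteq> N + B" unfolding NK using subset_plus(1)[OF N(1) B] by blast
  then have kerK0: "ker_on K0 f = ker_on K f" by (auto simp: K0_def ker_on_def)
  have f0: "f 0 = 0" by (rule linear_on_zero[OF f])
  have fB: "vs.subspace (f ` B \<inter> f ` K)"
    using vs.subspace_inter subspace_image_on[OF f B sub(1)] subspace_image_on[OF f K sub(2)] by blast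
  have zero: "{0} \<subseteq> f ` B \<inter> f ` K" using vs.subspace_0[OF fB] by (simp only: empty_subsetI insert_subset simp_thms)
  obtain t where t: "has_codim (f ` B \<inter> f ` K) {0} t" "r = e + t"
  proof -
    obtain e' t where et: "has_codim (f ` B) (f ` B \<inter> f ` K) e'" "has_codim (f ` B \<inter> f ` K) {0} t" "r = e' + t"
      using has_codim_between[OF r fB zero Int_lower1] .
    then show thesis using that has_codim_unique[OF e et(1)] by simp
  qed
  have codims: "has_codim N (N \<inter> B) s \<longleftrightarrow> has_codim K0 {0} s" for s
    using has_codim_plus_iff[OF N(1) B] has_codim_plus_iff[OF K0 B] by (simp add: split K0B)
  show ?thesis
  proof
    assume "commensurable (ker_on A f) B j"
    then obtain s r'' where s: "has_codim N (N \<inter> B) s" "has_codim B (N \<inter> B) r''" "j = int s - int r''"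
      unfolding N_def[symmetric] by (rule commensurable_Int)
    have j: "j = int s - int r" using s(3) has_codim_unique[OF s(2) r'] by simp
    obtain u k where k: "has_codim (f ` K0) (f ` {0}) u" "has_codim (ker_on K0 f) (ker_on {0} f) k" "s = u + k"
      by (rule has_codim_image_kernel[OF s(1)[unfolded codims] f K0A])
    have "u = t" using has_codim_unique[OF _ t(1)] k(1) by (simp add: f0 fK0)
    have "ker_on {0} f = {0}" by (auto simp: ker_on_def f0)
    then have "has_codim (ker_on K f) {0} k" using k(2) by (simp add: kerK0)
    moreover have "j + int e = int k" using j k(3) t(2) \<open>u = t\<close> by simp
    ultimately show "commensurable (ker_on K f) {0} (j + int e)" using commensurable_codim by simp
  next
    assume "commensurable (ker_on K f) {0} (j + int e)"
    moreover have "{0} \<subseteq> ker_on K f" using vs.subspace_0[OF K] f0 by (simp add: ker_on_def)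
    ultimately obtain k where k: "has_codim (ker_on K f) {0} k" "j + int e = int k"
      by (rule commensurable_nested)
    have "has_codim K0 (ker_on K f) t"
      using kernel_codim[OF linear_on_subset[OF f K0 K0A]] t(1) by (simp add: fK0 kerK0)
    then have "has_codim N (N \<inter> B) (t + k)" using has_codim_trans k(1) codims by blast
    moreover have "j = int (t + k) - int r" using k(2) t(2) by simp
    ultimately show "commensurable (ker_on A f) B j"
      unfolding N_def[symmetric] using r' by (intro commensurableI)
  qed
qed

text \<open>This collects the numbers that control the removal of the top space \<open>C\<close>: \<open>a\<close> is the
codimension of \<open>g ` E\<close> in \<open>g ` C\<close>, \<open>b\<close> is the dimension of the kernel of \<open>g\<close>, and \<open>e\<close> is the
codimension of \<open>f ` K\<close> in \<open>f ` A\<close>. In the index, \<open>a\<close> and \<open>b\<close> add up to \<open>l\<close>, and \<open>e\<close> cancels because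
it occurs in two adjacent terms.\<close>

lemma split_off_index:
  assumes g: "linear_on C g" and E: "has_codim C E l" and inj: "ker_on E g = {0}"
    and f: "linear_on A f" and CA: "g ` C \<subseteq> A" and K: "vs.subspace K"
    and A: "g ` E + K = A" "g ` E \<inter> K = {0}"
    and fin: "has_codim (f ` g ` C) {0} r0"
  obtains a b e where "a + b = l" "has_codim (ker_on C g) {0} b"
    "\<forall>i. commensurable (ker_on A f) (g ` C) i \<longleftrightarrow> commensurable (ker_on K f) {0} (i + int a + int e)"
    "\<forall>N i. commensurable N (f ` A) i \<longleftrightarrow> commensurable N (f ` K) (i + int e)"
proof -
  note EC = has_codim_subspace[OF E]
  define B where "B = g ` E"
  have B: "vs.subspace B" "B \<subseteq> g ` C" using subspace_image_on[OF g EC(2,3)] EC(3) by (auto simp: B_def)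
  have sub: "B \<subseteq> A" "K \<subseteq> A" using subset_plus[OF B(1) K] A(1) by (auto simp: B_def)
  have sfB: "vs.subspace (f ` B)" and sfK: "vs.subspace (f ` K)"
    using subspace_image_on[OF f] B(1) K sub by auto
  obtain a b where ab: "has_codim (g ` C) B a" "has_codim (ker_on C g) {0} b" "l = a + b"
    using has_codim_image_kernel[OF E g order.refl] unfolding inj B_def .
  have zero: "{0} \<subseteq> f ` B" "{0} \<subseteq> f ` B \<inter> f ` K"
    using vs.subspace_0[OF sfB] vs.subspace_0[OF sfK]
    by (simp_all only: empty_subsetI insert_subset Int_iff simp_thms)
  obtain r where r: "has_codim (f ` B) {0} r"
    using has_codim_between[OF fin sfB zero(1) image_mono[OF B(2)]] .
  obtain e where e: "has_codim (f ` B) (f ` B \<inter> f ` K) e"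
    using has_codim_between[OF r vs.subspace_inter[OF sfB sfK] zero(2) Int_lower1] .
  have "f ` A = f ` B + f ` K"
  proof (intro equalityI subsetI)
    fix y assume "y \<in> f ` A"
    then obtain b k where *: "b \<in> B" "k \<in> K" "y = f (b + k)"
      using A(1) by (auto simp: B_def[symmetric] elim!: set_plus_elim)
    then have "y = f b + f k" using linear_on_add[OF f, of b k] sub by auto
    then show "y \<in> f ` B + f ` K" using set_plus_intro[OF imageI[OF *(1)] imageI[OF *(2)]] by simp
  next
    fix y assume "y \<in> f ` B + f ` K"
    then obtain b k where *: "b \<in> B" "k \<in> K" "y = f b + f k" by (auto elim!: set_plus_elim)
    then have "y = f (b + k)" using linear_on_add[OF f subsetD[OF sub(1) *(1)] subsetD[OF sub(2) *(2)]] by simp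
    moreover have "b + k \<in> A" using * A(1) by (auto simp: B_def intro: set_plus_intro)
    ultimately show "y \<in> f ` A" by blast
  qed
  then have "commensurable (f ` A) (f ` K) (int e)"
    using commensurable_codim has_codim_plus_iff[OF sfB sfK] e by simp
  then have 2: "\<forall>N i. commensurable N (f ` A) i \<longleftrightarrow> commensurable N (f ` K) (i + int e)"
    by (intro allI) (rule commensurable_right_iff)
  have 1: "\<forall>i. commensurable (ker_on A f) (g ` C) i \<longleftrightarrow> commensurable (ker_on K f) {0} (i + int a + int e)"
    using commensurable_right_iff[OF commensurable_codim[OF ab(1)]]
      kernel_commensurable_split[OF f B(1) K A[folded B_def] r e] by simp
  show thesis using that[OF ab(3)[symmetric] ab(2) 1 2] .
qed

section \<open>Quotient dimensions\<close>

lemma coset_eq_iff: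
  assumes "vs.subspace W" shows "coset W x = coset W y \<longleftrightarrow> x - y \<in> W"
proof
  assume "coset W x = coset W y"
  moreover have "x \<in> coset W x" using vs.subspace_0[OF assms] by (force simp: coset_def)
  ultimately show "x - y \<in> W" by (auto simp: coset_def)
next
  assume *: "x - y \<in> W"
  have "coset W x \<subseteq> coset W y" if "x - y \<in> W" for x y
  proof
    fix z assume "z \<in> coset W x"
    then obtain w where w: "w \<in> W" "z = x + w" by (auto simp: coset_def)
    then have "z = y + ((x - y) + w)" by simp
    moreover have "(x - y) + w \<in> W" by (rule vs.subspace_add[OF assms that w(1)])
    ultimately show "z \<in> coset W y" unfolding coset_def by (rule image_eqI)
  qed
  from this[OF *] this[of y x] vs.subspace_neg[OF assms *] show "coset W x = coset W y" by simp
qed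

lemma quotient_basis_iff:
  assumes "vs.subspace W"
  shows "quotient_basis smul V W F \<longleftrightarrow> finite F \<and> F \<subseteq> V \<and>
    (\<forall>u. (\<Sum>x\<in>F. u x \<odot> x) \<in> W \<longrightarrow> (\<forall>x\<in>F. u x = 0)) \<and>
    (\<forall>v\<in>V. \<exists>u. v - (\<Sum>x\<in>F. u x \<odot> x) \<in> W)"
  unfolding quotient_basis_def quotient_space_def by (simp add: coset_eq_iff[OF assms])

text \<open>A basis of a quotient corresponds vector by vector to a chain of one-vector extensions.\<close>

lemma quotient_basis_insert:
  assumes W: "vs.subspace W" and V: "vs.subspace V" "W \<subseteq> V" and x: "x \<notin> F"
  shows "quotient_basis smul V W (insert x F) \<longleftrightarrow>
    x \<in> V \<and> x \<notin> W \<and> quotient_basis smul V (vs.span (insert x W)) F"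
proof (cases "finite F")
  case True
  let ?U = "vs.span (insert x W)" and ?S = "\<lambda>u. \<Sum>y\<in>F. u y \<odot> y"
  have upd: "?S (u(x := k)) = ?S u" for u k using x by (intro sum.cong) auto
  have ins: "(\<Sum>y\<in>insert x F. u y \<odot> y) = u x \<odot> x + ?S u" for u using x True by simp
  note mem = mem_span_insert[OF W]
  have span: "(\<exists>u. v - (u x \<odot> x + ?S u) \<in> W) \<longleftrightarrow> (\<exists>u. v - ?S u \<in> ?U)" for v
  proof
    assume "\<exists>u. v - (u x \<odot> x + ?S u) \<in> W"
    then obtain u where "v - (u x \<odot> x + ?S u) \<in> W" ..
    then have "v - ?S u - u x \<odot> x \<in> W" by (simp only: diff_diff_eq add.commute)
    then show "\<exists>u. v - ?S u \<in> ?U" unfolding mem by (intro exI)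
  next
    assume "\<exists>u. v - ?S u \<in> ?U"
    then obtain u k where "v - ?S u - k \<odot> x \<in> W" unfolding mem by blast
    then show "\<exists>u. v - (u x \<odot> x + ?S u) \<in> W"
      by (intro exI[of _ "u(x := k)"]) (simp only: upd fun_upd_same diff_diff_eq add.commute)
  qed
  have ind: "(\<forall>u. u x \<odot> x + ?S u \<in> W \<longrightarrow> (\<forall>y\<in>insert x F. u y = 0)) \<longleftrightarrow>
    x \<notin> W \<and> (\<forall>u. ?S u \<in> ?U \<longrightarrow> (\<forall>y\<in>F. u y = 0))" (is "?L \<longleftrightarrow> ?R")
  proof
    assume L: ?L
    have "x \<notin> W"
    proof
      assume xW: "x \<in> W"
      define u where "u y = (if y = x then 1 else 0 :: 'k)" for y
      have "?S u = 0" using x by (intro sum.neutral) (auto simp: u_def)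
      then have "u x \<odot> x + ?S u \<in> W" using xW by (simp add: u_def)
      then have "u x = 0" using L by blast
      then show False by (simp add: u_def)
    qed
    moreover have "\<forall>y\<in>F. u y = 0" if u: "?S u \<in> ?U" for u
    proof -
      obtain k where "?S u - k \<odot> x \<in> W" using u unfolding mem by blast
      then have "(- k) \<odot> x + ?S u \<in> W" by simp
      then have "(u(x := - k)) x \<odot> x + ?S (u(x := - k)) \<in> W" by (simp only: upd fun_upd_same)
      then have *: "\<forall>y\<in>insert x F. (u(x := - k)) y = 0" using L by blast
      show ?thesis
      proof
        fix y assume "y \<in> F"
        then show "u y = 0" using x *[rule_format, of y] by (cases "y = x") auto
      qed
    qed
    ultimately show ?R by blast
  next
    assume R: ?R
    show ?L
    proof (intro allI impI)
      fix u assume u: "u x \<odot> x + ?S u \<in> W"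
      have "?S u \<in> ?U" unfolding mem using u by (intro exI[of _ "- u x"]) (simp add: add.commute)
      then have F: "\<forall>y\<in>F. u y = 0" using R by blast
      then have "?S u = 0" by simp
      then have "u x \<odot> x \<in> W" using u by simp
      have "u x = 0"
      proof (rule ccontr)
        assume "u x \<noteq> 0"
        then have "x \<in> W" using vs.subspace_scale[OF W \<open>u x \<odot> x \<in> W\<close>, of "inverse (u x)"] by simp
        then show False using R by blast
      qed
      then show "\<forall>y\<in>insert x F. u y = 0" using F by blast
    qed
  qed
  show ?thesis
    unfolding quotient_basis_iff[OF W] quotient_basis_iff[OF vs.subspace_span] ins span ind insert_subset finite_insert
    by satx
qed (simp add: quotient_basis_def)

lemma quotient_basis_has_codim:
  assumes "vs.subspace W" "vs.subspace V" "W \<subseteq> V" "quotient_basis smul V W F"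
  shows "has_codim V W (card F)"
proof -
  have "finite F" using assms(4) by (simp add: quotient_basis_def)
  then show ?thesis using assms
  proof (induction F arbitrary: W rule: finite_induct)
    case empty
    then have "V = W" by (auto simp: quotient_basis_iff)
    then show ?case using empty by (simp add: has_codim_0)
  next
    case (insert x F)
    from insert.prems(4)[unfolded quotient_basis_insert[OF insert.prems(1,2,3) insert.hyps(2)]]
    have x: "x \<in> V" "x \<notin> W" "quotient_basis smul V (vs.span (insert x W)) F" by auto
    have "has_codim V (vs.span (insert x W)) (card F)"
      by (rule insert.IH[OF vs.subspace_span insert.prems(2) span_insert_subset[OF insert.prems(2,3) x(1)] x(3)])
    then show ?case using has_codim.step[OF insert.prems(1) x(2)] insert.hyps by simp
  qed
qed

lemma has_codim_quotient_basis:
  "has_codim V W d \<Longrightarrow> \<exists>F. quotient_basis smul V W F"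
proof (induction rule: has_codim.induct)
  case (same W)
  then show ?case by (intro exI[of _ "{}"]) (simp add: quotient_basis_iff)
next
  case (step W v V d)
  then obtain F where F: "quotient_basis smul V (vs.span (insert v W)) F" by blast
  note V = has_codim_subspace[OF step.hyps(3)]
  have WV: "W \<subseteq> V" and vV: "v \<in> V"
    using V(3) subset_span_insert[of W v] mem_span_insert_self[of v W] by auto
  have "v \<notin> F"
  proof
    assume v: "v \<in> F"
    have "finite F" using F by (simp add: quotient_basis_def)
    then have "(\<Sum>x\<in>F. (if x = v then 1 else 0) \<odot> x) = v" using v
      by (simp add: if_distrib[of "\<lambda>c. c \<odot> _"] sum.delta cong: if_cong)
    then have "\<forall>x\<in>F. (if x = v then 1 else 0 :: 'k) = 0"
      using F[unfolded quotient_basis_iff[OF vs.subspace_span]] mem_span_insert_self[of v W]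
      by (elim conjE allE[of _ "\<lambda>x. if x = v then 1 else 0"]) simp
    then show False using v by auto
  qed
  then show ?case using quotient_basis_insert[OF step.hyps(1) V(1) WV] F vV step.hyps(2) by blast
qed

lemma quotient_finite_dim_iff:
  assumes "vs.subspace W" "vs.subspace V" "W \<subseteq> V"
  shows "quotient_finite_dim smul V W \<longleftrightarrow> has_codim V W (quotient_dim smul V W)"
proof
  assume "quotient_finite_dim smul V W"
  then have "quotient_basis smul V W (SOME F. quotient_basis smul V W F)"
    unfolding quotient_finite_dim_def by (rule someI_ex)
  then show "has_codim V W (quotient_dim smul V W)"
    unfolding quotient_dim_def by (rule quotient_basis_has_codim[OF assms])
next
  assume "has_codim V W (quotient_dim smul V W)"
  then show "quotient_finite_dim smul V W"
    unfolding quotient_finite_dim_def by (rule has_codim_quotient_basis)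
qed

lemma has_codim_quotient_dim:
  assumes "has_codim V W d" shows "quotient_finite_dim smul V W" "quotient_dim smul V W = d"
proof -
  note s = has_codim_subspace[OF assms]
  show 1: "quotient_finite_dim smul V W"
    unfolding quotient_finite_dim_def by (rule has_codim_quotient_basis[OF assms])
  show "quotient_dim smul V W = d"
    using has_codim_unique[OF 1[unfolded quotient_finite_dim_iff[OF s(2,1,3)]] assms] .
qed

lemma commensurable_iff_quotients:
  assumes A: "vs.subspace A" and B: "vs.subspace B"
  shows "commensurable A B i \<longleftrightarrow>
    quotient_finite_dim smul A (A \<inter> B) \<and> quotient_finite_dim smul B (A \<inter> B) \<and>
    i = int (quotient_dim smul A (A \<inter> B)) - int (quotient_dim smul B (A \<inter> B))"
proof
  assume "commensurable A B i"
  then obtain a b where "has_codim A (A \<inter> B) a" "has_codim B (A \<inter> B) b" "i = int a - int b"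
    by (rule commensurable_Int)
  then show "quotient_finite_dim smul A (A \<inter> B) \<and> quotient_finite_dim smul B (A \<inter> B) \<and>
    i = int (quotient_dim smul A (A \<inter> B)) - int (quotient_dim smul B (A \<inter> B))"
    by (simp add: has_codim_quotient_dim)
next
  have "vs.subspace (A \<inter> B)" by (rule vs.subspace_inter[OF A B])
  then show "commensurable A B i" if "quotient_finite_dim smul A (A \<inter> B) \<and> quotient_finite_dim smul B (A \<inter> B) \<and>
    i = int (quotient_dim smul A (A \<inter> B)) - int (quotient_dim smul B (A \<inter> B))"
    using that A B by (intro commensurableI[of A "A \<inter> B"]) (auto simp: quotient_finite_dim_iff)
qed

lemma finite_dim_has_codim:
  assumes "finite_dim smul V" obtains d where "has_codim V {0} d"
proof -
  obtain B where B: "finite B" "V = vs.span B" using assms unfolding finite_dim_def by blast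
  have "\<exists>d. has_codim (vs.span B) {0} d" using B(1)
  proof (induction B rule: finite_induct)
    case empty
    show ?case using has_codim.same[OF vs.subspace_single_0] by (simp only: vs.span_empty) blast
  next
    case (insert x B)
    then obtain d where d: "has_codim (vs.span B) {0} d" by blast
    have eq: "vs.span (insert x B) = vs.span (insert x (vs.span B))"
    proof (intro equalityI vs.span_minimal vs.subspace_span)
      show "insert x B \<subseteq> vs.span (insert x (vs.span B))"
        using mem_span_insert_self subset_span_insert vs.span_superset by blast
      show "insert x (vs.span B) \<subseteq> vs.span (insert x B)"
        using mem_span_insert_self vs.span_mono[OF subset_insertI] by blast
    qed
    show ?case
    proof (cases "x \<in> vs.span B")
      case True
      then have "vs.span (insert x (vs.span B)) = vs.span B" by (simp add: insert_absorb vs.span_span)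
      then show ?thesis using d eq by auto
    next
      case False
      then show ?thesis using has_codim_trans[OF has_codim_line[OF vs.subspace_span False] d] eq by auto
    qed
  qed
  then show thesis using that B(2) by blast
qed

section \<open>Removing the top space of a sequence\<close>

text \<open>The algebraic part of \<^const>\<open>hilbert_sequence\<close>.\<close>

definition linear_sequence :: "nat \<Rightarrow> (int \<Rightarrow> 'b set) \<Rightarrow> (int \<Rightarrow> 'b \<Rightarrow> 'b) \<Rightarrow> bool"
  where "linear_sequence n H \<delta> \<longleftrightarrow>
    (\<forall>p. linear_on (H p) (\<delta> p) \<and> \<delta> p ` H p \<subseteq> H (p - 1)) \<and>
    (\<forall>p. p < 0 \<or> p \<ge> int n + 1 \<longrightarrow> H p = {0})"

lemma linear_sequenceD:
  assumes "linear_sequence n H \<delta>"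
  shows "linear_on (H p) (\<delta> p)" "\<delta> p ` H p \<subseteq> H (p - 1)" "p < 0 \<or> p \<ge> int n + 1 \<Longrightarrow> H p = {0}"
  using assms[unfolded linear_sequence_def] by (elim conjE allE[of _ p], blast)+

text \<open>The numbers \<open>t p\<close> are the terms of the index without sign. They are demanded for all \<open>p\<close>, so that
the notion is the same for every bound on the length of the sequence.\<close>

definition fredholm_with :: "(int \<Rightarrow> 'b set) \<Rightarrow> (int \<Rightarrow> 'b \<Rightarrow> 'b) \<Rightarrow> (int \<Rightarrow> int) \<Rightarrow> bool"
  where "fredholm_with H \<delta> t \<longleftrightarrow> (\<forall>p. commensurable (Ns H \<delta> p) (Rs H \<delta> (p + 1)) (t p))"

text \<open>The summand at \<open>-1\<close> is always zero in the applications. It is included so that removing the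
top space changes three consecutive summands even if only \<open>H 1\<close> and \<open>H 0\<close> are present.\<close>

definition alternating_sum :: "nat \<Rightarrow> (int \<Rightarrow> int) \<Rightarrow> int"
  where "alternating_sum n t = (\<Sum>p\<in>{-1..int n}. (if even p then 1 else -1) * t p)"

lemma alternating_sum_split:
  assumes "\<And>p. p < int m - 1 \<Longrightarrow> t p = t' p"
  shows "alternating_sum (Suc m) t - alternating_sum m t' =
    (if even m then - 1 else 1) * (t (int m + 1) - (t (int m) - t' (int m)) + (t (int m - 1) - t' (int m - 1)))"
proof -
  let ?s = "\<lambda>p::int. if even p then 1 else - 1 :: int"
  define S where "S = (\<Sum>p\<in>{-1..int m - 2}. ?s p * t p)"
  have S': "S = (\<Sum>p\<in>{-1..int m - 2}. ?s p * t' p)"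
    unfolding S_def
  proof (rule sum.cong[OF refl])
    fix p assume "p \<in> {-1..int m - 2}"
    then have "p < int m - 1" by simp
    then show "?s p * t p = ?s p * t' p" by (simp only: assms)
  qed
  have 1: "{-1..int (Suc m)} = insert (int m + 1) (insert (int m) (insert (int m - 1) {-1..int m - 2}))"
    and 2: "{-1..int m} = insert (int m) (insert (int m - 1) {-1..int m - 2})" by auto
  have "alternating_sum (Suc m) t = ?s (int m + 1) * t (int m + 1) + (?s (int m) * t (int m) + (?s (int m - 1) * t (int m - 1) + S))"
    unfolding alternating_sum_def 1 S_def by simp
  moreover have "alternating_sum m t' = ?s (int m) * t' (int m) + (?s (int m - 1) * t' (int m - 1) + S)"
    unfolding alternating_sum_def 2 S' by simp
  ultimately show ?thesis by (simp add: algebra_simps)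
qed

text \<open>Only the terms of the index at \<open>m + 1\<close>, \<open>m\<close> and \<open>m - 1\<close> change. With the numbers of
\<open>split_off_index\<close>, the first one loses \<open>b\<close>, the second one gains \<open>a + e\<close> and the third one
gains \<open>e\<close>; with alternating signs this amounts to \<open>a + b = l\<close>.\<close>

lemma reduce_sequence:
  assumes seq: "linear_sequence (Suc m) H \<delta>"
    and fin: "\<And>p. \<exists>d. has_codim (\<delta> p ` \<delta> (p + 1) ` H (p + 1)) {0} d"
    and E: "has_codim (H (int m + 1)) E l" and inj: "ker_on E (\<delta> (int m + 1)) = {0}"
    and K: "vs.subspace K"
    and A: "\<delta> (int m + 1) ` E + K = H (int m)" "\<delta> (int m + 1) ` E \<inter> K = {0}"
  defines "H' \<equiv> H(int m + 1 := {0}, int m := K)"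
    and "c \<equiv> (if even m then - 1 else 1) * int l"
  shows "linear_sequence m H' \<delta>"
    and "fredholm_with H \<delta> t \<Longrightarrow> \<exists>t'. fredholm_with H' \<delta> t' \<and> alternating_sum (Suc m) t = alternating_sum m t' + c"
    and "fredholm_with H' \<delta> t' \<Longrightarrow> \<exists>t. fredholm_with H \<delta> t \<and> alternating_sum (Suc m) t = alternating_sum m t' + c"
proof -
  let ?C = "H (int m + 1)" and ?A = "H (int m)" and ?g = "\<delta> (int m + 1)" and ?f = "\<delta> (int m)"
  have lin: "linear_on (H p) (\<delta> p)" and into: "\<delta> p ` H p \<subseteq> H (p - 1)" for p
    using seq by (auto simp: linear_sequence_def)
  have H0: "H p = {0}" if "p < 0 \<or> p \<ge> int m + 2" for p
    using seq that by (auto simp: linear_sequence_def)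
  have z: "\<delta> p ` {0} = {0}" "ker_on {0} (\<delta> p) = {0}" for p
    using linear_on_zero[OF lin] by (auto simp: ker_on_def)
  have EC: "vs.subspace E" "E \<subseteq> ?C" using has_codim_subspace[OF E] by auto
  have KA: "K \<subseteq> ?A" using subset_plus(2)[OF subspace_image_on[OF lin EC] K] A(1) by simp
  have H': "H' (int m + 1) = {0}" "H' (int m) = K" "\<And>p. p \<noteq> int m + 1 \<Longrightarrow> p \<noteq> int m \<Longrightarrow> H' p = H p"
    by (auto simp: H'_def)
  have H'sub: "vs.subspace (H' p) \<and> H' p \<subseteq> H p" for p
    using K KA linear_on_subspace[OF lin, of p] vs.subspace_0[OF linear_on_subspace[OF lin], of p]
      vs.subspace_single_0 by (cases "p = int m + 1") (simp_all add: H'_def)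
  show "linear_sequence m H' \<delta>"
    unfolding linear_sequence_def
  proof (intro conjI allI impI)
    fix p
    show "linear_on (H' p) (\<delta> p)" by (rule linear_on_subset[OF lin conjunct1[OF H'sub] conjunct2[OF H'sub]])
    show "\<delta> p ` H' p \<subseteq> H' (p - 1)"
    proof (cases "p = int m + 1 \<or> p = int m + 2")
      case True
      then have "H' p = {0}" using H'(1) H'(3)[of p] H0[of p] by (elim disjE) simp_all
      then show ?thesis using vs.subspace_0[OF conjunct1[OF H'sub[of "p - 1"]]] by (simp add: linear_on_zero[OF lin])
    next
      case False
      then have "H' (p - 1) = H (p - 1)" using H'(3) by simp
      then show ?thesis using order.trans[OF image_mono[OF conjunct2[OF H'sub[of p]], of "\<delta> p"] into[of p]] by (simp only:)
    qed
  next
    fix p assume p: "p < 0 \<or> p \<ge> int m + 1"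
    show "H' p = {0}"
    proof (cases "p = int m + 1")
      case False
      with p have "p \<noteq> int m" "p < 0 \<or> p \<ge> int m + 2" by linarith+
      then show ?thesis using H'(3)[OF False] H0[of p] by simp
    qed (simp only: H'(1))
  qed
  have gC: "?g ` ?C \<subseteq> ?A" using into[of "int m + 1"] by simp
  obtain r0 where r0: "has_codim (?f ` ?g ` ?C) {0} r0" using fin[of "int m"] by (elim exE)
  obtain a b e where abe: "a + b = l" "has_codim (ker_on ?C ?g) {0} b"
    and one: "\<forall>i. commensurable (ker_on ?A ?f) (?g ` ?C) i \<longleftrightarrow> commensurable (ker_on K ?f) {0} (i + int a + int e)"
    and two: "\<forall>N i. commensurable N (?f ` ?A) i \<longleftrightarrow> commensurable N (?f ` K) (i + int e)"
    using split_off_index[OF lin E inj lin gC K A r0] .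
  have R: "Rs H \<delta> (int m + 1 + 1) = {0}" "Rs H' \<delta> (int m + 1 + 1) = {0}" "Rs H' \<delta> (int m + 1) = {0}"
    using H0[of "int m + 1 + 1"] H'(1) H'(3)[of "int m + 1 + 1"] by (simp_all add: linear_on_zero[OF lin])
  have top: "commensurable (Ns H \<delta> (int m + 1)) (Rs H \<delta> (int m + 1 + 1)) (int b)"
    unfolding R by (rule commensurable_codim[OF abe(2)])
  have top': "commensurable (Ns H' \<delta> (int m + 1)) (Rs H' \<delta> (int m + 1 + 1)) 0"
    unfolding R H'(1) z(2) using commensurable_codim[OF has_codim.same[OF vs.subspace_single_0]] by simp
  have mid: "commensurable (Ns H \<delta> (int m)) (Rs H \<delta> (int m + 1)) i \<longleftrightarrow>
    commensurable (Ns H' \<delta> (int m)) (Rs H' \<delta> (int m + 1)) (i + int a + int e)" for i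
    unfolding R H'(2) by (rule one[rule_format])
  have m: "int m - 1 + 1 = int m" "int m - 1 \<noteq> int m + 1" "int m - 1 \<noteq> int m" by simp_all
  have low: "commensurable (Ns H \<delta> (int m - 1)) (Rs H \<delta> (int m - 1 + 1)) i \<longleftrightarrow>
    commensurable (Ns H' \<delta> (int m - 1)) (Rs H' \<delta> (int m - 1 + 1)) (i + int e)" for i
    unfolding m(1) H'(2) H'(3)[OF m(2,3)] by (rule two[rule_format])
  have other: "Ns H' \<delta> p = Ns H \<delta> p \<and> Rs H' \<delta> (p + 1) = Rs H \<delta> (p + 1)"
    if "p \<noteq> int m + 1" "p \<noteq> int m" "p \<noteq> int m - 1" for p
    using that H'(3)[of p] H'(3)[of "p + 1"] by simp
  {
    assume t: "fredholm_with H \<delta> t"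
    define t' where "t' = t(int m + 1 := 0, int m := t (int m) + int a + int e, int m - 1 := t (int m - 1) + int e)"
    have "fredholm_with H' \<delta> t'"
      unfolding fredholm_with_def
    proof
      fix p
      have tp: "commensurable (Ns H \<delta> p) (Rs H \<delta> (p + 1)) (t p)" using t by (simp add: fredholm_with_def)
      consider "p = int m + 1" | "p = int m" | "p = int m - 1" | "p \<noteq> int m + 1" "p \<noteq> int m" "p \<noteq> int m - 1" by blast
      then show "commensurable (Ns H' \<delta> p) (Rs H' \<delta> (p + 1)) (t' p)"
      proof cases
        case 1
        then show ?thesis using top' by (simp add: t'_def)
      next
        case 2
        then show ?thesis using tp mid[of "t (int m)"] by (simp add: t'_def)
      next
        case 3
        then show ?thesis using tp low[of "t (int m - 1)"] by (simp add: t'_def)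
      next
        case 4
        then show ?thesis using tp other[OF 4] by (simp add: t'_def)
      qed
    qed
    moreover have "t (int m + 1) = int b"
      using t commensurable_unique[OF _ top] unfolding fredholm_with_def by blast
    then have "alternating_sum (Suc m) t - alternating_sum m t' = c"
      unfolding c_def abe(1)[symmetric]
      by (subst alternating_sum_split) (auto simp: t'_def)
    ultimately show "\<exists>t'. fredholm_with H' \<delta> t' \<and> alternating_sum (Suc m) t = alternating_sum m t' + c"
      by (intro exI[of _ t']) simp
  }
  {
    assume t': "fredholm_with H' \<delta> t'"
    define t where "t = t'(int m + 1 := int b, int m := t' (int m) - int a - int e, int m - 1 := t' (int m - 1) - int e)"
    have "fredholm_with H \<delta> t"
      unfolding fredholm_with_def
    proof
      fix p
      have tp: "commensurable (Ns H' \<delta> p) (Rs H' \<delta> (p + 1)) (t' p)" using t' by (simp add: fredholm_with_def)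
      consider "p = int m + 1" | "p = int m" | "p = int m - 1" | "p \<noteq> int m + 1" "p \<noteq> int m" "p \<noteq> int m - 1" by blast
      then show "commensurable (Ns H \<delta> p) (Rs H \<delta> (p + 1)) (t p)"
      proof cases
        case 1
        then show ?thesis using top by (simp add: t_def)
      next
        case 2
        then show ?thesis using tp mid[of "t (int m)"] by (simp add: t_def)
      next
        case 3
        then show ?thesis using tp low[of "t (int m - 1)"] by (simp add: t_def)
      next
        case 4
        then show ?thesis using tp other[OF 4] by (simp add: t_def)
      qed
    qed
    moreover have "alternating_sum (Suc m) t - alternating_sum m t' = c"
      unfolding c_def abe(1)[symmetric]
      by (subst alternating_sum_split[where t' = t']) (auto simp: t_def)
    ultimately show "\<exists>t. fredholm_with H \<delta> t \<and> alternating_sum (Suc m) t = alternating_sum m t' + c"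
      by (intro exI[of _ t]) simp
  }
qed

end

section \<open>Stability of bounded bijections\<close>

text \<open>The open mapping theorem is proved for real linear operators, so that it applies to the map
\<open>(e, k) \<mapsto> g e + k\<close> on a product, which is a vector space over the reals by its type.\<close>

locale bounded_linear_on =
  fixes X :: "'a::{real_normed_vector, complete_space} set"
    and T :: "'a \<Rightarrow> 'b::{real_normed_vector, complete_space}"
  assumes subspace: "subspace X" and closed: "closed X"
    and add: "x \<in> X \<Longrightarrow> y \<in> X \<Longrightarrow> T (x + y) = T x + T y"
    and scale: "x \<in> X \<Longrightarrow> T (r *\<^sub>R x) = r *\<^sub>R T x"
    and bounded: "\<exists>M. \<forall>x\<in>X. norm (T x) \<le> M * norm x"
begin

lemma zero: "T 0 = 0"
  using scale[of 0 0] subspace_0[OF subspace] by simp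

lemma diff:
  assumes "x \<in> X" "y \<in> X" shows "T (x - y) = T x - T y"
proof -
  have "T (x - y) + T y = T x" using add[of "x - y" y] subspace_diff[OF subspace] assms by simp
  then show ?thesis by (simp add: algebra_simps)
qed

lemma tendsto:
  assumes "\<And>n. s n \<in> X" "x \<in> X" "s \<longlonglongrightarrow> x" shows "(\<lambda>n. T (s n)) \<longlonglongrightarrow> T x"
proof -
  obtain M where M: "\<And>x. x \<in> X \<Longrightarrow> norm (T x) \<le> M * norm x" using bounded by blast
  have "norm (T (s n) - T x) \<le> M * norm (s n - x)" for n
    using M[OF subspace_diff[OF subspace assms(1,2)], of n] diff[OF assms(1,2), of n] by simp
  then have "\<forall>\<^sub>F n in sequentially. norm (T (s n) - T x) \<le> M * norm (s n - x)" by simp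
  moreover have "(\<lambda>n. M * norm (s n - x)) \<longlonglongrightarrow> 0"
    by (rule tendsto_mult_right_zero[OF tendsto_norm_zero[OF LIM_zero[OF assms(3)]]])
  ultimately have "(\<lambda>n. T (s n) - T x) \<longlonglongrightarrow> 0" by (rule Lim_null_comparison)
  then show ?thesis by (rule LIM_zero_cancel)
qed

lemma closed_preimage:
  assumes "closed N" shows "closed {x \<in> X. T x \<in> N}"
  unfolding closed_sequential_limits
proof (intro allI impI)
  fix s l assume s: "(\<forall>n. s n \<in> {x \<in> X. T x \<in> N}) \<and> s \<longlonglongrightarrow> l"
  then have sX: "\<And>n. s n \<in> X" "\<And>n. T (s n) \<in> N" and lim: "s \<longlonglongrightarrow> l" by auto
  have l: "l \<in> X" by (rule closed_sequentially[OF closed sX(1) lim])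
  have "T l \<in> N" by (rule closed_sequentially[OF assms sX(2) tendsto[OF sX(1) l lim]])
  with l show "l \<in> {x \<in> X. T x \<in> N}" by simp
qed

text \<open>If every equation \<open>T x = y\<close> can be solved up to an error of half the size of \<open>y\<close>, then
applying this to the error again and again gives a geometric series that converges to an exact
solution. The lemma serves twice, for the open mapping theorem and for its stability.\<close>

lemma solve_from_approximation:
  assumes Y: "subspace Y" "T ` X \<subseteq> Y" and C: "C \<ge> 0"
    and approx: "\<And>y. y \<in> Y \<Longrightarrow> \<exists>x\<in>X. norm x \<le> C * norm y \<and> norm (y - T x) \<le> norm y / 2"
    and y: "y \<in> Y"
  shows "\<exists>x\<in>X. norm x \<le> 2 * C * norm y \<and> T x = y"
proof -
  have "\<forall>y\<in>Y. \<exists>x. x \<in> X \<and> norm x \<le> C * norm y \<and> norm (y - T x) \<le> norm y / 2"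
    using approx by (simp only: Bex_def) blast
  from bchoice[OF this] obtain h where
    h: "\<forall>y\<in>Y. h y \<in> X \<and> norm (h y) \<le> C * norm y \<and> norm (y - T (h y)) \<le> norm y / 2" ..
  have hX: "h y \<in> X" and hC: "norm (h y) \<le> C * norm y" and hT: "norm (y - T (h y)) \<le> norm y / 2"
    if "y \<in> Y" for y using h that by simp_all
  \<comment> \<open>The errors of the successive approximations, whose solutions \<open>h (r i)\<close> are added up.\<close>
  define r where "r n = ((\<lambda>z. z - T (h z)) ^^ n) y" for n
  have r0: "r 0 = y" and rS: "r (Suc n) = r n - T (h (r n))" for n by (auto simp: r_def)
  have rY: "r n \<in> Y" for n
  proof (induction n)
    case (Suc n)
    then have "T (h (r n)) \<in> Y" using hX Y(2) by blast
    then show ?case using Suc subspace_diff[OF Y(1)] by (simp add: rS)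
  qed (simp add: r0 y)
  have rn: "norm (r n) \<le> norm y / 2 ^ n" for n
  proof (induction n)
    case (Suc n)
    have "norm (r (Suc n)) \<le> norm (r n) / 2" using hT[OF rY[of n]] by (simp add: rS)
    then show ?case using Suc by simp
  qed (simp add: r0)
  define s where "s n = (\<Sum>i<n. h (r i))" for n
  have sX: "s n \<in> X" for n
    unfolding s_def by (rule subspace_sum[OF subspace hX[OF rY]])
  have Ts: "T (s n) = y - r n" for n
  proof (induction n)
    case (Suc n)
    have "T (s (Suc n)) = T (s n) + T (h (r n))" using add[OF sX hX[OF rY], of n n] by (simp add: s_def)
    then show ?case using Suc by (simp add: rS)
  qed (simp add: s_def zero r0)
  have inc: "norm (s (n + k) - s n) \<le> C * norm y * (2 / 2 ^ n - 2 / 2 ^ (n + k))" for n k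
  proof (induction k)
    case (Suc k)
    have "s (n + Suc k) - s n = (s (n + k) - s n) + h (r (n + k))" by (simp add: s_def)
    then have "norm (s (n + Suc k) - s n) \<le> norm (s (n + k) - s n) + norm (h (r (n + k)))"
      by (simp only: norm_triangle_ineq)
    moreover have "norm (h (r (n + k))) \<le> C * (norm y / 2 ^ (n + k))"
      using hC[OF rY[of "n + k"]] mult_left_mono[OF rn[of "n + k"] C] by linarith
    ultimately have "norm (s (n + Suc k) - s n) \<le> C * norm y * (2 / 2 ^ n - 2 / 2 ^ (n + k)) + C * (norm y / 2 ^ (n + k))"
      using Suc by linarith
    also have "\<dots> = C * norm y * (2 / 2 ^ n - 2 / 2 ^ (n + Suc k))" by (simp add: field_simps)
    finally show ?case .
  qed simp
  have inc': "norm (s (n + k) - s n) \<le> 2 * C * norm y / 2 ^ n" for n k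
  proof -
    have "C * norm y * (2 / 2 ^ n - 2 / 2 ^ (n + k)) \<le> C * norm y * (2 / 2 ^ n)"
      using C by (intro mult_left_mono) auto
    from order.trans[OF inc this] show ?thesis by (simp add: mult_ac)
  qed
  have "(\<lambda>n. 2 * C * norm y * (1 / 2) ^ n) \<longlonglongrightarrow> 2 * C * norm y * 0"
    by (intro tendsto_intros LIMSEQ_realpow_zero) auto
  then have lim0: "(\<lambda>n. 2 * C * norm y / 2 ^ n) \<longlonglongrightarrow> 0" by (simp add: power_divide)
  have "Cauchy s"
  proof (rule CauchyI')
    fix e :: real assume "e > 0"
    then obtain N where N: "2 * C * norm y / 2 ^ N < e"
      using order_tendstoD(2)[OF lim0, of e] by (auto simp: eventually_sequentially)
    show "\<exists>M. \<forall>m\<ge>M. \<forall>n>m. dist (s m) (s n) < e"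
    proof (intro exI allI impI)
      fix m n :: nat assume mn: "N \<le> m" "m < n"
      then obtain k where k: "n = m + k" using less_imp_add_positive by blast
      have "2 * C * norm y / 2 ^ m \<le> 2 * C * norm y / 2 ^ N"
        using C mn(1) by (intro divide_left_mono power_increasing) auto
      then show "dist (s m) (s n) < e" using inc'[of m k] N by (simp add: k dist_norm norm_minus_commute)
    qed
  qed
  then obtain x where x: "s \<longlonglongrightarrow> x" using Cauchy_convergent convergent_def by blast
  have xX: "x \<in> X" using closed_sequentially[OF closed] sX x by blast
  have "norm (s n) \<le> 2 * C * norm y" for n using inc'[of 0 n] by (simp add: s_def)
  then have "norm x \<le> 2 * C * norm y" using Lim_bounded[OF tendsto_norm[OF x]] by blast
  moreover have "T x = y"
  proof (rule LIMSEQ_unique[OF tendsto[OF sX xX x]])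
    have "r \<longlonglongrightarrow> 0"
    proof (rule Lim_null_comparison[of _ "\<lambda>n. norm y * (1 / 2) ^ n"])
      show "\<forall>\<^sub>F n in sequentially. norm (r n) \<le> norm y * (1 / 2) ^ n" using rn by (simp add: power_divide)
      have "(\<lambda>n. norm y * (1 / 2) ^ n) \<longlonglongrightarrow> norm y * 0"
        by (intro tendsto_intros LIMSEQ_realpow_zero) auto
      then show "(\<lambda>n. norm y * (1 / 2) ^ n) \<longlonglongrightarrow> 0" by simp
    qed
    then have "(\<lambda>n. y - r n) \<longlonglongrightarrow> y - 0" by (intro tendsto_intros)
    then show "(\<lambda>n. T (s n)) \<longlonglongrightarrow> y" by (simp add: Ts)
  qed
  ultimately show ?thesis using xX by blast
qed

text \<open>This is the Baire category part of the open mapping theorem: one of the closures of the images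
of the balls of radius \<open>j\<close> has an interior point in \<open>Y\<close>.\<close>

lemma approximate_solutions:
  assumes Y: "closed Y" and surj: "T ` X = Y"
  shows "\<exists>C>0. \<forall>y\<in>Y. \<exists>x\<in>X. norm x \<le> C * norm y \<and> norm (y - T x) \<le> norm y / 2"
proof -
  define F where "F j = closure (T ` {x \<in> X. norm x \<le> real j})" for j :: nat
  have sub: "subspace Y"
    unfolding surj[symmetric]
  proof (rule subspaceI)
    show "0 \<in> T ` X" using zero[symmetric] subspace_0[OF subspace] by (rule image_eqI)
  next
    fix x y assume "x \<in> T ` X" "y \<in> T ` X"
    then obtain a b where ab: "a \<in> X" "b \<in> X" "x = T a" "y = T b" by (elim imageE)
    then have "x + y = T (a + b)" using add[of a b] by simp
    then show "x + y \<in> T ` X" using subspace_add[OF subspace ab(1,2)] by (rule image_eqI)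
  next
    fix c x assume "x \<in> T ` X"
    then obtain a where a: "a \<in> X" "x = T a" by (elim imageE)
    then have "c *\<^sub>R x = T (c *\<^sub>R a)" using scale[of a c] by simp
    then show "c *\<^sub>R x \<in> T ` X" using subspace_scale[OF subspace a(1)] by (rule image_eqI)
  qed
  have FY: "F j \<subseteq> Y" for j
  proof -
    have "T ` {x \<in> X. norm x \<le> real j} \<subseteq> Y" unfolding surj[symmetric] by blast
    then show ?thesis unfolding F_def by (rule closure_minimal[OF _ Y])
  qed
  have cover: "\<Union> (range F) = Y"
  proof (intro equalityI subsetI)
    fix y assume "y \<in> Y"
    then obtain x where x: "x \<in> X" "y = T x" unfolding surj[symmetric] by (elim imageE)
    obtain j where "norm x \<le> real j" using real_arch_simple by blast
    then have "y \<in> T ` {x \<in> X. norm x \<le> real j}" using x by blast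
    then have "y \<in> F j" unfolding F_def by (rule subsetD[OF closure_subset])
    then show "y \<in> \<Union> (range F)" by blast
  next
    fix y assume "y \<in> \<Union> (range F)"
    then obtain j where "y \<in> F j" by blast
    then show "y \<in> Y" by (rule subsetD[OF FY])
  qed
  have "\<exists>j. top_of_set Y interior_of F j \<noteq> {}"
  proof (rule ccontr)
    assume *: "\<not> ?thesis"
    have "completely_metrizable_space (top_of_set Y)"
      using Y completely_metrizable_space_closedin[OF completely_metrizable_space_euclidean] by simp
    then have cm: "completely_metrizable_space (top_of_set Y) \<or>
      locally_compact_space (top_of_set Y) \<and> regular_space (top_of_set Y)" by (rule disjI1)
    have "closed (F j)" for j by (simp only: F_def closed_closure)
    then have cl: "closedin (top_of_set Y) (F j)" for j by (rule closed_subset[OF FY])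
    have "top_of_set Y interior_of \<Union> (range F) = {}"
    proof (rule Baire_category_alt[OF cm countable_image[OF countableI_type]])
      fix S assume "S \<in> range F"
      then obtain j where "S = F j" by (rule imageE)
      then show "closedin (top_of_set Y) S \<and> top_of_set Y interior_of S = {}"
        using * by (simp add: cl)
    qed
    moreover have "top_of_set Y interior_of Y = Y"
      using interior_of_topspace[of "top_of_set Y"] by (simp only: topspace_euclidean_subtopology)
    ultimately have "Y = {}" using cover by simp
    then show False using subspace_0[OF sub] by simp
  qed
  then obtain j y0 where y0I: "y0 \<in> top_of_set Y interior_of F j" by (meson ex_in_conv)
  let ?U = "top_of_set Y interior_of F j"
  have U: "?U \<subseteq> Y \<and> (\<forall>x\<in>?U. \<exists>e>0. ball x e \<inter> Y \<subseteq> ?U)"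
    by (rule iffD1[OF openin_contains_ball openin_interior_of])
  have y0: "y0 \<in> Y" by (rule subsetD[OF conjunct1[OF U] y0I])
  from bspec[OF conjunct2[OF U] y0I]
  obtain \<rho> where \<rho>: "\<rho> > 0" "ball y0 \<rho> \<inter> Y \<subseteq> ?U" by (elim exE conjE)
  have ball: "ball y0 \<rho> \<inter> Y \<subseteq> F j" by (rule order.trans[OF \<rho>(2) interior_of_subset])
  \<comment> \<open>Small vectors are differences of two vectors near \<open>y0\<close>, both of which are almost attained.\<close>
  have near: "\<exists>x\<in>X. norm x \<le> 2 * real j \<and> norm (z - T x) \<le> \<rho> / 4" if z: "z \<in> Y" "norm z < \<rho>" for z
  proof -
    have "y0 + z \<in> ball y0 \<rho> \<inter> Y" "y0 \<in> ball y0 \<rho> \<inter> Y"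
      using z(2) \<rho>(1) y0 subspace_add[OF sub y0 z(1)] by (simp_all add: dist_norm)
    then have mem: "y0 + z \<in> F j" "y0 \<in> F j" using subsetD[OF ball] by simp_all
    have ex: "\<exists>x\<in>X. norm x \<le> real j \<and> norm (T x - v) < \<rho> / 8" if "v \<in> F j" for v
    proof -
      have "\<rho> / 8 > 0" using \<rho>(1) by simp
      with that[unfolded F_def closure_approachable]
      have "\<exists>w\<in>T ` {x \<in> X. norm x \<le> real j}. dist w v < \<rho> / 8" by (elim allE impE)
      then show ?thesis by (auto simp: dist_norm)
    qed
    obtain x1 where x1: "x1 \<in> X" "norm x1 \<le> real j" "norm (T x1 - (y0 + z)) < \<rho> / 8" using ex[OF mem(1)] by (elim bexE conjE)
    obtain x2 where x2: "x2 \<in> X" "norm x2 \<le> real j" "norm (T x2 - y0) < \<rho> / 8" using ex[OF mem(2)] by (elim bexE conjE)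
    have "z - T (x1 - x2) = (T x2 - y0) - (T x1 - (y0 + z))" using diff[OF x1(1) x2(1)] by simp
    then have "norm (z - T (x1 - x2)) \<le> norm (T x2 - y0) + norm (T x1 - (y0 + z))"
      by (simp only: norm_triangle_ineq4)
    then have "norm (z - T (x1 - x2)) \<le> \<rho> / 4" using x1(3) x2(3) by linarith
    moreover have "norm (x1 - x2) \<le> 2 * real j" using norm_triangle_ineq4[of x1 x2] x1(2) x2(2) by linarith
    moreover have "x1 - x2 \<in> X" using subspace_diff[OF subspace x1(1) x2(1)] .
    ultimately show ?thesis by (intro bexI conjI)
  qed
  \<comment> \<open>Rescaling \<open>y\<close> to norm \<open>\<rho> / 2\<close> yields the constant \<open>4 * j / \<rho>\<close>; adding \<open>1\<close> makes it positive.\<close>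
  define C where "C = 4 * real j / \<rho> + 1"
  have "\<exists>x\<in>X. norm x \<le> C * norm y \<and> norm (y - T x) \<le> norm y / 2" if y: "y \<in> Y" for y
  proof (cases "y = 0")
    case True
    then show ?thesis using subspace_0[OF subspace] zero by (intro bexI[of _ 0]) auto
  next
    case False
    define a where "a = \<rho> / (2 * norm y)"
    have a: "a > 0" using \<rho> False by (simp add: a_def)
    have "norm (a *\<^sub>R y) = \<rho> / 2" using \<rho>(1) False by (simp add: a_def)
    then obtain x where x: "x \<in> X" "norm x \<le> 2 * real j" "norm (a *\<^sub>R y - T x) \<le> \<rho> / 4"
      using near[of "a *\<^sub>R y"] subspace_scale[OF sub y] \<rho>(1) by auto
    let ?x = "inverse a *\<^sub>R x"
    have ia: "inverse a = 2 * norm y / \<rho>" by (simp add: a_def)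
    have "norm ?x \<le> inverse a * (2 * real j)" using x(2) a by (simp add: mult_left_mono)
    also have "\<dots> \<le> C * norm y" unfolding ia C_def using \<rho>(1) by (simp add: field_simps)
    finally have 1: "norm ?x \<le> C * norm y" .
    have "y - T ?x = inverse a *\<^sub>R (a *\<^sub>R y - T x)" using a scale[OF x(1)] by (simp add: algebra_simps)
    then have "norm (y - T ?x) = inverse a * norm (a *\<^sub>R y - T x)" using a by simp
    also have "\<dots> \<le> inverse a * (\<rho> / 4)" using x(3) a by (intro mult_left_mono) auto
    also have "\<dots> = norm y / 2" unfolding ia using \<rho>(1) by simp
    finally have 2: "norm (y - T ?x) \<le> norm y / 2" .
    show ?thesis using 1 2 subspace_scale[OF subspace x(1)] by blast
  qed
  moreover have "C > 0" using \<rho>(1) by (simp add: C_def add_nonneg_pos)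
  ultimately show ?thesis by blast
qed

end

text \<open>The open mapping theorem gives solutions with \<open>norm x \<le> C * norm (T x)\<close>. If \<open>T'\<close> differs from \<open>T\<close>
by at most \<open>1 / (2 * C)\<close>, then the solution for \<open>T\<close> is an approximate solution for \<open>T'\<close> with an
error of at most one half, and this can be improved to an exact one.\<close>

lemma bijection_stable:
  assumes T: "bounded_linear_on X T" and Y: "subspace Y" "closed Y"
    and surj: "T ` X = Y" and inj: "\<And>x. x \<in> X \<Longrightarrow> T x = 0 \<Longrightarrow> x = 0"
  shows "\<exists>\<epsilon>>0. \<forall>T'. bounded_linear_on X T' \<longrightarrow> T' ` X \<subseteq> Y \<longrightarrow>
    (\<forall>x\<in>X. norm (T' x - T x) \<le> \<epsilon> * norm x) \<longrightarrow> T' ` X = Y \<and> (\<forall>x\<in>X. T' x = 0 \<longrightarrow> x = 0)"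
proof -
  interpret T: bounded_linear_on X T by (rule T)
  from T.approximate_solutions[OF Y(2) surj] obtain C0 where C0: "C0 > 0"
    "\<forall>y\<in>Y. \<exists>x\<in>X. norm x \<le> C0 * norm y \<and> norm (y - T x) \<le> norm y / 2"
    by (elim exE conjE)
  define C where "C = 2 * C0"
  have C: "C > 0" using C0(1) by (simp add: C_def)
  have solve: "\<exists>x\<in>X. norm x \<le> C * norm y \<and> T x = y" if "y \<in> Y" for y
    unfolding C_def by (rule T.solve_from_approximation[OF Y(1) eq_refl[OF surj] less_imp_le[OF C0(1)] C0(2)[rule_format] that])
  have below: "norm x \<le> C * norm (T x)" if x: "x \<in> X" for x
  proof -
    have "T x \<in> Y" unfolding surj[symmetric] by (rule imageI[OF x])
    from solve[OF this] obtain x' where x': "x' \<in> X" "norm x' \<le> C * norm (T x)" "T x' = T x"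
      by (elim bexE conjE)
    have "T (x - x') = 0" unfolding T.diff[OF x x'(1)] x'(3) by simp
    then have "x - x' = 0" by (rule inj[OF subspace_diff[OF T.subspace x x'(1)]])
    then have "x = x'" by simp
    then show ?thesis using x'(2) by simp
  qed
  define \<epsilon> where "\<epsilon> = 1 / (2 * C)"
  have "T' ` X = Y \<and> (\<forall>x\<in>X. T' x = 0 \<longrightarrow> x = 0)"
    if T': "bounded_linear_on X T'" "T' ` X \<subseteq> Y" and close: "\<forall>x\<in>X. norm (T' x - T x) \<le> \<epsilon> * norm x" for T'
  proof -
    interpret T': bounded_linear_on X T' by (rule T'(1))
    have "\<exists>x\<in>X. norm x \<le> C * norm y \<and> norm (y - T' x) \<le> norm y / 2" if y: "y \<in> Y" for y
    proof -
      from solve[OF y] obtain x where x: "x \<in> X" "norm x \<le> C * norm y" "T x = y" by (elim bexE conjE)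
      have "norm (y - T' x) \<le> \<epsilon> * norm x" using close[rule_format, OF x(1)] x(3) by (simp add: norm_minus_commute)
      also have "\<dots> \<le> \<epsilon> * (C * norm y)" using x(2) C by (intro mult_left_mono) (auto simp: \<epsilon>_def)
      also have "\<dots> = norm y / 2" using C by (simp add: \<epsilon>_def)
      finally show ?thesis using x(1,2) by (intro bexI conjI)
    qed
    then have "\<exists>x\<in>X. norm x \<le> 2 * C * norm y \<and> T' x = y" if "y \<in> Y" for y
      by (rule T'.solve_from_approximation[OF Y(1) T'(2) less_imp_le[OF C] _ that])
    then have "Y \<subseteq> T' ` X" by blast
    with T'(2) have "T' ` X = Y" by (rule equalityI)
    moreover have "x = 0" if x: "x \<in> X" "T' x = 0" for x
    proof -
      have "norm x \<le> C * norm (T x)" by (rule below[OF x(1)])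
      also have "\<dots> \<le> C * (\<epsilon> * norm x)" using close[rule_format, OF x(1)] x(2) C by (intro mult_left_mono) auto
      also have "\<dots> = norm x / 2" using C by (simp add: \<epsilon>_def)
      finally show ?thesis by simp
    qed
    ultimately show ?thesis by (intro conjI ballI impI)
  qed
  moreover have "\<epsilon> > 0" using C by (simp add: \<epsilon>_def)
  ultimately show ?thesis by blast
qed

text \<open>A direct decomposition of \<open>Y\<close> into \<open>g ` E\<close> and \<open>K\<close>, with \<open>g\<close> injective, is the same as
bijectivity of \<open>(e, k) \<mapsto> g e + k\<close> on \<open>E \<times> K\<close>, which persists under small changes of \<open>g\<close>.\<close>

lemma direct_sum_stable:
  fixes E K Y :: "'a::{real_normed_vector, complete_space} set"
  assumes g: "bounded_linear_on E g" and K: "subspace K" "closed K" and Y: "subspace Y" "closed Y"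
    and sum: "g ` E + K = Y" "g ` E \<inter> K = {0}" and inj: "\<And>x. x \<in> E \<Longrightarrow> g x = 0 \<Longrightarrow> x = 0"
  shows "\<exists>\<epsilon>>0. \<forall>g'. bounded_linear_on E g' \<longrightarrow> g' ` E \<subseteq> Y \<longrightarrow>
    (\<forall>x\<in>E. norm (g' x - g x) \<le> \<epsilon> * norm x) \<longrightarrow>
    g' ` E + K = Y \<and> g' ` E \<inter> K = {0} \<and> (\<forall>x\<in>E. g' x = 0 \<longrightarrow> x = 0)"
proof -
  interpret g: bounded_linear_on E g by (rule g)
  define S where "S f = (\<lambda>z. f (fst z) + snd z)" for f :: "'a \<Rightarrow> 'a"
  have S: "bounded_linear_on (E \<times> K) (S f)" if "bounded_linear_on E f" for f
  proof -
    interpret f: bounded_linear_on E f by (rule that)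
    obtain M where M: "\<And>x. x \<in> E \<Longrightarrow> norm (f x) \<le> M * norm x" using f.bounded by blast
    show ?thesis
    proof
      show "subspace (E \<times> K)" by (rule subspace_Times[OF f.subspace K(1)])
      show "closed (E \<times> K)" by (rule closed_Times[OF f.closed K(2)])
      show "S f (x + y) = S f x + S f y" if "x \<in> E \<times> K" "y \<in> E \<times> K" for x y
        using that f.add[of "fst x" "fst y"] by (auto simp: S_def)
      show "S f (r *\<^sub>R x) = r *\<^sub>R S f x" if "x \<in> E \<times> K" for x r
        using that f.scale[of "fst x"] by (auto simp: S_def algebra_simps)
      have "norm (S f z) \<le> (\<bar>M\<bar> + 1) * norm z" if z: "z \<in> E \<times> K" for z
      proof -
        have "norm (S f z) \<le> norm (f (fst z)) + norm (snd z)" unfolding S_def by (rule norm_triangle_ineq)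
        also have "norm (f (fst z)) \<le> \<bar>M\<bar> * norm (fst z)"
          using M[of "fst z"] z mult_right_mono[OF abs_ge_self[of M] norm_ge_zero[of "fst z"]] by fastforce
        also have "\<bar>M\<bar> * norm (fst z) + norm (snd z) \<le> \<bar>M\<bar> * norm z + norm z"
          using norm_fst_le[of "fst z" "snd z"] norm_snd_le[of "snd z" "fst z"]
          by (intro add_mono mult_left_mono) auto
        finally show ?thesis by (simp add: algebra_simps)
      qed
      then show "\<exists>M. \<forall>x\<in>E \<times> K. norm (S f x) \<le> M * norm x" by blast
    qed
  qed
  have im: "S f ` (E \<times> K) = f ` E + K" for f
    by (force simp: S_def set_plus_def)
  have "x = 0" if "x \<in> E \<times> K" "S g x = 0" for x
  proof -
    obtain e k where x: "x = (e, k)" "e \<in> E" "k \<in> K" using \<open>x \<in> E \<times> K\<close> by blast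
    have "g e = - k" using \<open>S g x = 0\<close> by (simp add: S_def x eq_neg_iff_add_eq_0)
    then have "g e \<in> K" using subspace_neg[OF K(1) x(3)] by simp
    then have "g e = 0" using sum(2) x(2) by blast
    then show ?thesis using inj[OF x(2)] \<open>g e = - k\<close> x(1) by (simp add: zero_prod_def)
  qed
  then obtain \<epsilon> where \<epsilon>: "\<epsilon> > 0" and stable: "\<And>T'. bounded_linear_on (E \<times> K) T' \<Longrightarrow> T' ` (E \<times> K) \<subseteq> Y \<Longrightarrow>
    \<forall>x\<in>E \<times> K. norm (T' x - S g x) \<le> \<epsilon> * norm x \<Longrightarrow> T' ` (E \<times> K) = Y \<and> (\<forall>x\<in>E \<times> K. T' x = 0 \<longrightarrow> x = 0)"
    using bijection_stable[OF S[OF g] Y, unfolded im, OF sum(1)] by blast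
  have "g' ` E + K = Y \<and> g' ` E \<inter> K = {0} \<and> (\<forall>x\<in>E. g' x = 0 \<longrightarrow> x = 0)"
    if g': "bounded_linear_on E g'" "g' ` E \<subseteq> Y" and close: "\<forall>x\<in>E. norm (g' x - g x) \<le> \<epsilon> * norm x" for g'
  proof -
    interpret g': bounded_linear_on E g' by (rule g'(1))
    have KY: "K \<subseteq> Y"
    proof
      fix k assume "k \<in> K"
      then have "g 0 + k \<in> g ` E + K" using subspace_0[OF g.subspace] by (intro set_plus_intro) auto
      then show "k \<in> Y" using sum(1) g.zero by simp
    qed
    have "S g' ` (E \<times> K) \<subseteq> Y" using g'(2) KY subspace_add[OF Y(1)] by (force simp: S_def)
    moreover have "norm (S g' x - S g x) \<le> \<epsilon> * norm x" if "x \<in> E \<times> K" for x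
    proof -
      have "norm (S g' x - S g x) \<le> \<epsilon> * norm (fst x)" using close that by (auto simp: S_def)
      also have "\<dots> \<le> \<epsilon> * norm x" using \<epsilon> norm_fst_le[of "fst x" "snd x"] by (intro mult_left_mono) auto
      finally show ?thesis .
    qed
    ultimately have st: "S g' ` (E \<times> K) = Y" "\<And>x. x \<in> E \<times> K \<Longrightarrow> S g' x = 0 \<Longrightarrow> x = 0"
      using stable[OF S[OF g'(1)]] by blast+
    have inj': "x = 0" if "x \<in> E" "g' x = 0" for x
      using st(2)[of "(x, 0)"] that subspace_0[OF K(1)] by (simp add: S_def zero_prod_def)
    have "y = 0" if y: "y \<in> g' ` E" "y \<in> K" for y
    proof -
      obtain e where e: "e \<in> E" "y = g' e" using y(1) by blast
      then have "(e, - y) = 0" using st(2)[of "(e, - y)"] subspace_neg[OF K(1) y(2)] by (simp add: S_def)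
      then show "y = 0" by (simp add: zero_prod_def)
    qed
    moreover have "0 \<in> g' ` E" "0 \<in> K" using g'.zero subspace_0[OF g'.subspace] subspace_0[OF K(1)] by force+
    ultimately show ?thesis using st(1) inj' by (auto simp: im)
  qed
  then show ?thesis using \<epsilon> by blast
qed

section \<open>Orthogonal complements\<close>

text \<open>By the parallelogram law every minimizing sequence is a Cauchy sequence.\<close>

lemma nearest_point:
  fixes M :: "'a::{real_inner, complete_space} set"
  assumes M: "subspace M" "closed M"
  shows "\<exists>p\<in>M. \<forall>m\<in>M. norm (x - p) \<le> norm (x - m)"
proof -
  \<comment> \<open>The squared distance, because the parallelogram law is about squares.\<close>
  define D where "D = (INF m\<in>M. (norm (x - m))\<^sup>2)"
  have bdd: "bdd_below ((\<lambda>m. (norm (x - m))\<^sup>2) ` M)" by (rule bdd_belowI2[of _ 0]) simp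
  have ne: "M \<noteq> {}" using subspace_0[OF M(1)] by blast
  have D: "D \<le> (norm (x - m))\<^sup>2" if "m \<in> M" for m
    unfolding D_def by (rule cINF_lower[OF bdd that])
  have "\<exists>m. m \<in> M \<and> (norm (x - m))\<^sup>2 < D + 1 / real (Suc n)" for n
  proof -
    have "(INF m\<in>M. (norm (x - m))\<^sup>2) < D + 1 / real (Suc n)" unfolding D_def[symmetric] by simp
    then show ?thesis unfolding cINF_less_iff[OF ne bdd] by (simp only: Bex_def)
  qed
  then have "\<forall>n. \<exists>m. m \<in> M \<and> (norm (x - m))\<^sup>2 < D + 1 / real (Suc n)" ..
  from choice[OF this] obtain m where "\<forall>n. m n \<in> M \<and> (norm (x - m n))\<^sup>2 < D + 1 / real (Suc n)" ..
  then have m: "m n \<in> M" "(norm (x - m n))\<^sup>2 < D + 1 / real (Suc n)" for n by simp_all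
  have dist: "(norm (m i - m j))\<^sup>2 \<le> 2 / real (Suc i) + 2 / real (Suc j)" for i j
  proof -
    define a b where "a = x - m i" and "b = x - m j"
    have par: "(norm (a - b))\<^sup>2 = 2 * (norm a)\<^sup>2 + 2 * (norm b)\<^sup>2 - (norm (a + b))\<^sup>2"
      unfolding power2_norm_eq_inner by (simp add: inner_diff_left inner_diff_right inner_add_left inner_add_right inner_commute)
    define c where "c = (1 / 2) *\<^sub>R (m i + m j)"
    have c: "c \<in> M" unfolding c_def by (rule subspace_scale[OF M(1) subspace_add[OF M(1) m(1) m(1)]])
    have "2 *\<^sub>R (x - c) = a + b" by (simp add: a_def b_def c_def algebra_simps scaleR_2)
    then have "norm (a + b) = norm (2 *\<^sub>R (x - c))" by (simp only:)
    then have "(norm (a + b))\<^sup>2 = 4 * (norm (x - c))\<^sup>2" by (simp add: power_mult_distrib)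
    moreover have "m i - m j = - (a - b)" by (simp add: a_def b_def)
    then have "norm (m i - m j) = norm (a - b)" by (simp only: norm_minus_cancel)
    ultimately show ?thesis using par D[OF c] m(2)[of i, folded a_def] m(2)[of j, folded b_def] by simp
  qed
  have "Cauchy m"
  proof (rule CauchyI')
    fix e :: real assume e: "e > 0"
    then have "e\<^sup>2 / 4 > 0" by simp
    then obtain N where N: "inverse (real (Suc N)) < e\<^sup>2 / 4" using reals_Archimedean by blast
    show "\<exists>M. \<forall>i\<ge>M. \<forall>j>i. dist (m i) (m j) < e"
    proof (intro exI allI impI)
      fix i j :: nat assume ij: "N \<le> i" "i < j"
      have "1 / real (Suc i) \<le> 1 / real (Suc N)" "1 / real (Suc j) \<le> 1 / real (Suc N)"
        using ij by (intro divide_left_mono; simp)+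
      then have "(norm (m i - m j))\<^sup>2 < e\<^sup>2" using dist[of i j] N by (simp add: inverse_eq_divide)
      then show "dist (m i) (m j) < e" unfolding dist_norm by (rule power2_less_imp_less) (use e in simp)
    qed
  qed
  then obtain p where p: "m \<longlonglongrightarrow> p" using Cauchy_convergent convergent_def by blast
  have pM: "p \<in> M" using closed_sequentially[OF M(2) _ p] m(1) by simp
  have "(\<lambda>n. (norm (x - m n))\<^sup>2) \<longlonglongrightarrow> (norm (x - p))\<^sup>2" by (intro tendsto_intros p)
  moreover have "(\<lambda>n. D + 1 / real (Suc n)) \<longlonglongrightarrow> D + 0"
    by (intro tendsto_add tendsto_const) (rule LIMSEQ_Suc[OF lim_1_over_n])
  ultimately have pD: "(norm (x - p))\<^sup>2 \<le> D + 0"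
    by (rule LIMSEQ_le) (use m(2) in \<open>auto intro: less_imp_le\<close>)
  have "norm (x - p) \<le> norm (x - q)" if "q \<in> M" for q
  proof (rule power2_le_imp_le)
    show "(norm (x - p))\<^sup>2 \<le> (norm (x - q))\<^sup>2" by (rule order.trans[OF pD[unfolded add_0_right] D[OF that]])
  qed simp
  with pM show ?thesis by (intro bexI[of _ p] ballI)
qed

locale hilbert_algebra = linear_algebra smul + hs: hilbert_space smul ip
  for smul :: "'k::real_or_complex \<Rightarrow> 'a::{real_inner, complete_space} \<Rightarrow> 'a" (infixr \<open>\<odot>\<close> 75)
    and ip :: "'a \<Rightarrow> 'a \<Rightarrow> 'k"
begin

lemma real_subspace:
  assumes "vs.subspace S" shows "subspace S"
proof (rule subspaceI)
  show "0 \<in> S" by (rule vs.subspace_0[OF assms])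
  show "x + y \<in> S" if "x \<in> S" "y \<in> S" for x y by (rule vs.subspace_add[OF assms that])
  show "r *\<^sub>R x \<in> S" if "x \<in> S" for r x
    using vs.subspace_scale[OF assms that, of "of_real r"] by (simp add: hs.scale_of_real)
qed

lemma ip_zero_left: "ip 0 y = 0"
  using hs.ip_scale_left[of 0 0 y] by simp

lemma conj_zero: "conj (0::'k) = 0"
  using conj_add[of "0::'k" 0] by simp

lemma ip_zero_right: "ip x 0 = 0"
  using hs.ip_commute[of x 0] by (simp add: ip_zero_left conj_zero)

lemma ip_zero_commute: "ip x y = 0 \<Longrightarrow> ip y x = 0"
  using hs.ip_commute[of y x] by (simp add: conj_zero)

lemma ip_add_right: "ip x (y + z) = ip x y + ip x z"
  using hs.ip_commute[of x "y + z"] hs.ip_commute[of x y] hs.ip_commute[of x z]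
  by (simp add: hs.ip_add_left conj_add)

lemma ip_scale_right: "ip x (c \<odot> y) = conj c * ip x y"
  using hs.ip_commute[of x "c \<odot> y"] hs.ip_commute[of x y]
  by (simp add: hs.ip_scale_left conj_mult)

lemma mult_conj_of_real: "a * conj a = (of_real ((norm a)\<^sup>2) :: 'k)"
  by (simp only: mult_conj of_real_def)

lemma norm_smul: "norm (c \<odot> x) = norm c * norm x"
proof -
  have "of_real ((norm (c \<odot> x))\<^sup>2) = c * (conj c * ip x x)"
    unfolding hs.ip_self[symmetric] hs.ip_scale_left ip_scale_right by (rule mult.left_commute)
  also have "\<dots> = (c * conj c) * ip x x" by (simp only: mult.assoc)
  also have "\<dots> = of_real ((norm c * norm x)\<^sup>2)"
    by (simp only: mult_conj_of_real hs.ip_self of_real_mult[symmetric] power_mult_distrib)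
  finally have "(norm (c \<odot> x))\<^sup>2 = (norm c * norm x)\<^sup>2" by (simp only: of_real_eq_iff)
  then show ?thesis by (rule power2_eq_imp_eq) simp_all
qed

text \<open>The usual computation of the distance from a line. It is the source of the Cauchy-Schwarz
inequality and of the orthogonality of the nearest point.\<close>

lemma norm_diff_projection:
  assumes "v \<noteq> 0"
  shows "(norm (x - (ip x v / of_real ((norm v)\<^sup>2)) \<odot> v))\<^sup>2 = (norm x)\<^sup>2 - (norm (ip x v))\<^sup>2 / (norm v)\<^sup>2"
proof -
  define N where "N = (of_real ((norm v)\<^sup>2) :: 'k)"
  define a where "a = ip x v"
  define d where "d = - (a / N)"
  have N: "N \<noteq> 0" "ip v v = N" using assms by (simp_all add: N_def hs.ip_self)
  have conjN: "conj N = N" using hs.ip_commute[of v v] by (simp add: N(2))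
  have "conj d * N = conj (d * N)" by (simp add: conj_mult conjN)
  also have "d * N = - a" using N by (simp add: d_def)
  finally have dN: "conj d * N = conj (- a)" .
  have conj_neg: "conj (- a) = - conj a"
    using conj_add[of "- a" a] by (simp add: conj_zero eq_neg_iff_add_eq_0)
  have vx: "ip v x = conj a" unfolding a_def by (rule hs.ip_commute)
  have "of_real ((norm (x + d \<odot> v))\<^sup>2) = ip (x + d \<odot> v) (x + d \<odot> v)" by (rule hs.ip_self[symmetric])
  also have "\<dots> = ip x x + conj d * a + d * (conj a + conj d * N)"
    by (simp add: hs.ip_add_left ip_add_right hs.ip_scale_left ip_scale_right vx N(2) a_def[symmetric] algebra_simps)
  also have "conj a + conj d * N = 0" by (simp add: dN conj_neg)
  also have "conj d = - conj a / N" using dN N(1) by (simp add: conj_neg field_simps)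
  finally have "of_real ((norm (x + d \<odot> v))\<^sup>2) = ip x x - a * conj a / N" by (simp add: mult.commute)
  also have "\<dots> = of_real ((norm x)\<^sup>2 - (norm a)\<^sup>2 / (norm v)\<^sup>2)"
    by (simp only: mult_conj_of_real hs.ip_self N_def of_real_diff of_real_divide)
  finally have "(norm (x + d \<odot> v))\<^sup>2 = (norm x)\<^sup>2 - (norm a)\<^sup>2 / (norm v)\<^sup>2" by (simp only: of_real_eq_iff)
  then show ?thesis by (simp add: d_def N_def a_def)
qed

lemma cauchy_schwarz: "norm (ip x v) \<le> norm x * norm v"
proof (cases "v = 0")
  case False
  have "0 \<le> (norm x)\<^sup>2 - (norm (ip x v))\<^sup>2 / (norm v)\<^sup>2"
    unfolding norm_diff_projection[OF False, symmetric] by simp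
  then have "(norm (ip x v))\<^sup>2 \<le> (norm x * norm v)\<^sup>2"
    using False by (simp add: pos_divide_le_eq power_mult_distrib)
  then show ?thesis by (rule power2_le_imp_le) simp
qed (simp add: ip_zero_right)

lemma bounded_linear_ip: "bounded_linear (\<lambda>x. ip x v)"
proof (rule bounded_linear_intro)
  show "ip (x + y) v = ip x v + ip y v" for x y by (rule hs.ip_add_left)
  show "ip (r *\<^sub>R x) v = r *\<^sub>R ip x v" for r x
    by (simp only: hs.scale_of_real[symmetric] hs.ip_scale_left scaleR_conv_of_real)
  show "norm (ip x v) \<le> norm x * norm v" for x by (rule cauchy_schwarz)
qed

definition perp :: "'a set \<Rightarrow> 'a set"
  where "perp M = {x. \<forall>m\<in>M. ip x m = 0}"

lemma perp_subspace: "vs.subspace (perp M)"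
  by (rule vs.subspaceI) (simp_all add: perp_def ip_zero_left hs.ip_add_left hs.ip_scale_left)

lemma perp_closed: "closed (perp M)"
proof -
  have "perp M = (\<Inter>m\<in>M. {x. ip x m = 0})" by (auto simp: perp_def)
  moreover have "closed {x. ip x m = 0}" for m
    by (rule closed_Collect_eq[OF linear_continuous_on[OF bounded_linear_ip] continuous_on_const])
  ultimately show ?thesis by (simp add: closed_INT)
qed

lemma Int_perp: "0 \<in> M \<Longrightarrow> M \<inter> perp M = {0}"
proof -
  have "x = 0" if "x \<in> M" "x \<in> perp M" for x
  proof -
    have "ip x x = 0" using that by (simp add: perp_def)
    then show "x = 0" by (simp add: hs.ip_self)
  qed
  moreover assume "0 \<in> M"
  ultimately show ?thesis using vs.subspace_0[OF perp_subspace] by blast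
qed

lemma projection:
  assumes M: "vs.subspace M" "closed M"
  obtains m where "m \<in> M" "x - m \<in> perp M"
proof -
  obtain p where p: "p \<in> M" "\<forall>m\<in>M. norm (x - p) \<le> norm (x - m)"
    using nearest_point[OF real_subspace[OF M(1)] M(2), of x] by (elim bexE)
  have "ip (x - p) m = 0" if m: "m \<in> M" for m
  proof (cases "m = 0")
    case False
    \<comment> \<open>Moving \<open>p\<close> by \<open>c \<odot> m\<close> would bring it nearer to \<open>x\<close> unless \<open>c = 0\<close>.\<close>
    define c where "c = ip (x - p) m / of_real ((norm m)\<^sup>2)"
    have "p + c \<odot> m \<in> M" by (rule vs.subspace_add[OF M(1) p(1) vs.subspace_scale[OF M(1) m]])
    then have "norm (x - p) \<le> norm (x - (p + c \<odot> m))" by (rule bspec[OF p(2)])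
    then have "(norm (x - p))\<^sup>2 \<le> (norm (x - p - c \<odot> m))\<^sup>2" by (simp add: diff_diff_eq power_mono)
    then have "(norm (ip (x - p) m))\<^sup>2 / (norm m)\<^sup>2 \<le> 0"
      unfolding c_def norm_diff_projection[OF False] by simp
    then have "(norm (ip (x - p) m))\<^sup>2 \<le> 0" using False by (simp add: divide_le_0_iff)
    then show ?thesis by simp
  qed (simp add: ip_zero_right)
  then have "x - p \<in> perp M" by (simp add: perp_def)
  with p(1) show thesis by (rule that)
qed

text \<open>No completeness of the scalar field is presupposed, so the coefficients of a convergent sequence
cannot simply be passed to the limit. Instead, the coefficient of \<open>y\<close> at the component \<open>u\<close> of \<open>v\<close>
orthogonal to \<open>S\<close> is read off with the inner product; then the span is the preimage of \<open>S\<close> under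
the continuous map that subtracts this component.\<close>

lemma closed_span_insert:
  assumes S: "vs.subspace S" "closed S"
  shows "closed (vs.span (insert v S))"
proof -
  obtain s where s: "s \<in> S" "v - s \<in> perp S" by (rule projection[OF S])
  define u where "u = v - s"
  have uS: "u \<in> vs.span (insert v S)" using span_insertI[OF S(1) vs.subspace_neg[OF S(1) s(1)], of 1 v] by (simp add: u_def)
  show ?thesis
  proof (cases "u = 0")
    case True
    then have "v \<in> S" using s by (simp add: u_def)
    then have "vs.span (insert v S) = S" using S(1) by (simp add: insert_absorb)
    then show ?thesis using S(2) by simp
  next
    case False
    define P where "P y = (ip y u / of_real ((norm u)\<^sup>2)) \<odot> u" for y
    have "bounded_linear P"
    proof (rule bounded_linear_intro[where K = 1])
      show "P (x + y) = P x + P y" for x y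
        by (simp add: P_def hs.ip_add_left add_divide_distrib vs.scale_left_distrib)
      show "P (r *\<^sub>R x) = r *\<^sub>R P x" for r x
        by (simp add: P_def hs.scale_of_real[symmetric] hs.ip_scale_left)
      show "norm (P x) \<le> norm x * 1" for x
      proof -
        have "norm (P x) = norm (ip x u) / (norm u)\<^sup>2 * norm u"
          by (simp add: P_def norm_smul norm_divide norm_power)
        also have "\<dots> = norm (ip x u) / norm u" using False by (simp add: power2_eq_square)
        also have "\<dots> \<le> norm x" using cauchy_schwarz[of x u] False by (simp add: pos_divide_le_eq)
        finally show ?thesis by simp
      qed
    qed
    then have "continuous_on UNIV (\<lambda>y. y - P y)"
      by (intro continuous_intros linear_continuous_on)
    then have "closed ((\<lambda>y. y - P y) -` S)" by (rule closed_vimage[OF S(2)])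
    moreover have "(\<lambda>y. y - P y) -` S = vs.span (insert v S)"
    proof (intro equalityI subsetI)
      fix y assume "y \<in> (\<lambda>y. y - P y) -` S"
      then have "y - P y \<in> vs.span (insert v S)" by (simp add: vs.span_base)
      moreover have "P y \<in> vs.span (insert v S)" unfolding P_def by (rule vs.span_scale[OF uS])
      ultimately have "(y - P y) + P y \<in> vs.span (insert v S)" by (rule vs.span_add)
      then show "y \<in> vs.span (insert v S)" by simp
    next
      fix y assume "y \<in> vs.span (insert v S)"
      then obtain w k where w: "w \<in> S" "y = w + k \<odot> v" by (rule span_insertE[OF S(1)])
      have q: "w + k \<odot> s \<in> S" by (rule vs.subspace_add[OF S(1) w(1) vs.subspace_scale[OF S(1) s(1)]])
      have y: "y = (w + k \<odot> s) + k \<odot> u" by (simp add: w(2) u_def vs.scale_right_diff_distrib)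
      have "ip u (w + k \<odot> s) = 0" using s(2) q by (simp add: perp_def u_def)
      then have "ip y u = k * of_real ((norm u)\<^sup>2)"
        unfolding y hs.ip_add_left hs.ip_scale_left[of k u u] hs.ip_self[of u]
        using ip_zero_commute[of u "w + k \<odot> s"] by (simp add: hs.ip_add_left)
      then have "P y = k \<odot> u" using False by (simp add: P_def)
      then show "y \<in> (\<lambda>y. y - P y) -` S" using q y by simp
    qed
    ultimately show ?thesis by simp
  qed
qed

lemma has_codim_closed: "has_codim V W d \<Longrightarrow> closed W \<Longrightarrow> closed V"
proof (induction rule: has_codim.induct)
  case (step W v V d)
  then show ?case using closed_span_insert by simp
qed

section \<open>A splitting that is stable under perturbation\<close>

lemma bounded_operators_linear:
  "f \<in> bounded_operators smul X Y \<Longrightarrow> vs.subspace X \<Longrightarrow> linear_on X f"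
  by (simp add: bounded_operators_def linear_on_def)

lemma bounded_operators_bounded:
  assumes f: "f \<in> bounded_operators smul X Y" and E: "vs.subspace E" "closed E" "E \<subseteq> X"
  shows "bounded_linear_on E f"
proof
  show "subspace E" by (rule real_subspace[OF E(1)])
  show "closed E" by (rule E(2))
  show "f (x + y) = f x + f y" if "x \<in> E" "y \<in> E" for x y
    using f subsetD[OF E(3) that(1)] subsetD[OF E(3) that(2)] by (simp add: bounded_operators_def)
  show "f (r *\<^sub>R x) = r *\<^sub>R f x" if "x \<in> E" for x r
    using f subsetD[OF E(3) that] by (simp add: bounded_operators_def hs.scale_of_real[symmetric])
  obtain K where "\<forall>x\<in>X. norm (f x) \<le> K * norm x" using f by (auto simp: bounded_operators_def)
  then show "\<exists>M. \<forall>x\<in>E. norm (f x) \<le> M * norm x" using E(3) by blast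
qed

text \<open>In a sequence, \<open>X\<close> is the top space, \<open>Y\<close> the next one and \<open>N\<close> the kernel of the operator on \<open>Y\<close>.
It is essential that \<open>E\<close> and \<open>K\<close> are the same for all operators close to \<open>g\<close>.\<close>

lemma stable_splitting:
  assumes X: "vs.subspace X" "closed X" and Y: "vs.subspace Y" "closed Y"
    and g: "g \<in> bounded_operators smul X Y" and N: "vs.subspace N" "closed N" "N \<subseteq> Y"
    and c: "has_codim N (N \<inter> g ` X) c" and r: "has_codim (g ` X) (N \<inter> g ` X) r"
    and b: "has_codim (ker_on X g) {0} b"
  obtains E l K \<epsilon> where "has_codim X E l" "vs.subspace K" "closed K" "K \<subseteq> Y" "\<epsilon> > 0"
    "\<forall>g'\<in>bounded_operators smul X Y. (\<forall>x\<in>X. norm (g' x - g x) \<le> \<epsilon> * norm x) \<longrightarrow>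
      ker_on E g' = {0} \<and> g' ` E + K = Y \<and> g' ` E \<inter> K = {0}"
proof -
  have lin: "linear_on X g" by (rule bounded_operators_linear[OF g X(1)])
  interpret gX: bounded_linear_on X g by (rule bounded_operators_bounded[OF g X order.refl])
  define Z where "Z = ker_on X g"
  \<comment> \<open>On \<open>D\<close> the range of \<open>g\<close> is \<open>N \<inter> g ` X\<close>, and removing the kernel \<open>Z\<close> makes \<open>g\<close> injective
    without changing this range.\<close>
  define D where "D = {x \<in> X. g x \<in> N}"
  define E where "E = D \<inter> perp Z"
  have g0: "g 0 = 0" by (rule gX.zero)
  have Z: "vs.subspace Z" "closed Z" "Z \<subseteq> D"
    using subspace_kernel[OF lin] gX.closed_preimage[of "{0}"] vs.subspace_0[OF N(1)]
    by (auto simp: Z_def D_def ker_on_def)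
  have D: "vs.subspace D" "closed D"
    unfolding D_def by (rule subspace_preimage_on[OF lin X(1) order.refl N(1)], rule gX.closed_preimage[OF N(2)])
  have XD: "has_codim X D r"
  proof -
    have "{x \<in> X. g x \<in> g ` X} = X" "{x \<in> X. g x \<in> N \<inter> g ` X} = D" by (auto simp: D_def)
    then show ?thesis using has_codim_preimage[OF r lin order.refl] by (simp only:)
  qed
  have E: "vs.subspace E" "closed E" "E \<subseteq> X"
    unfolding E_def by (rule vs.subspace_inter[OF D(1) perp_subspace], rule closed_Int[OF D(2) perp_closed])
      (auto simp: D_def)
  have split: "\<exists>z e. z \<in> Z \<and> e \<in> E \<and> x = z + e" if x: "x \<in> D" for x
  proof -
    obtain z where z: "z \<in> Z" "x - z \<in> perp Z" by (rule projection[OF Z(1,2)])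
    have "x - z \<in> E" unfolding E_def using z vs.subspace_diff[OF D(1) x subsetD[OF Z(3) z(1)]] by simp
    then show ?thesis using z(1) by (intro exI[of _ z] exI[of _ "x - z"]) simp
  qed
  have ZE: "Z \<inter> E = {0}"
    using Int_perp[OF vs.subspace_0[OF Z(1)]] Z(3) by (auto simp: E_def)
  have "Z + E = D"
  proof (intro equalityI subsetI)
    fix x assume "x \<in> Z + E"
    then obtain z e where "z \<in> Z" "e \<in> E" "x = z + e" by (rule set_plus_elim)
    then show "x \<in> D" using vs.subspace_add[OF D(1), of z e] Z(3) by (auto simp: E_def)
  next
    fix x assume "x \<in> D"
    from split[OF this] show "x \<in> Z + E" by (elim exE conjE) (simp add: set_plus_intro)
  qed
  then have DE: "has_codim D E b" using has_codim_plus_iff[OF Z(1) E(1), of b, unfolded ZE] b[folded Z_def] by simp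
  have gE: "g ` E = N \<inter> g ` X"
  proof (intro equalityI subsetI)
    fix y assume "y \<in> g ` E"
    then show "y \<in> N \<inter> g ` X" by (auto simp: E_def D_def)
  next
    fix y assume "y \<in> N \<inter> g ` X"
    then obtain x where x: "x \<in> D" "y = g x" by (auto simp: D_def)
    from split[OF x(1)] obtain z e where ze: "z \<in> Z" "e \<in> E" "x = z + e" by (elim exE conjE)
    then have "g x = g z + g e" using gX.add[of z e] E(3) by (auto simp: Z_def ker_on_def)
    then have "y = g e" using ze(1) x(2) by (simp add: Z_def ker_on_def)
    then show "y \<in> g ` E" using ze(2) by (rule image_eqI)
  qed
  define W where "W = N \<inter> g ` X"
  from has_codim_complement[OF c] obtain G where
    G: "has_codim G {0} c" "G \<inter> W = {0}" "G + W = N" unfolding W_def by (elim exE conjE)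
  have W: "vs.subspace W" "W \<subseteq> N" using has_codim_subspace(2)[OF c] by (auto simp: W_def)
  have sG: "vs.subspace G" by (rule has_codim_subspace(1)[OF G(1)])
  have GN: "G \<subseteq> N" using subset_plus(1)[OF sG W(1)] by (simp only: G(3))
  define S where "S = Y \<inter> perp N"
  have S: "vs.subspace S" "closed S"
    unfolding S_def by (rule vs.subspace_inter[OF Y(1) perp_subspace], rule closed_Int[OF Y(2) perp_closed])
  have NS: "N \<inter> S = {0}"
    using Int_perp[OF vs.subspace_0[OF N(1)]] vs.subspace_0[OF S(1)] by (auto simp: S_def)
  \<comment> \<open>\<open>K\<close> is closed as a finite dimensional extension of the closed subspace \<open>S\<close>.\<close>
  define K where "K = G + S"
  have sK: "vs.subspace K" unfolding K_def by (rule subspace_plus[OF sG S(1)])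
  have "G \<inter> S = {0}" using NS GN vs.subspace_0[OF sG] by auto
  then have "has_codim K S c" unfolding K_def using has_codim_plus_iff[OF sG S(1), of c] G(1) by simp
  then have cK: "closed K" using S(2) by (rule has_codim_closed)
  have KY: "K \<subseteq> Y"
  proof
    fix k assume "k \<in> K"
    then obtain a s where "a \<in> G" "s \<in> S" "k = a + s" unfolding K_def by (rule set_plus_elim)
    then show "k \<in> Y" using vs.subspace_add[OF Y(1), of a s] GN N(3) by (auto simp: S_def)
  qed
  have sum: "g ` E + K = Y"
    unfolding gE W_def[symmetric]
  proof (intro equalityI subsetI)
    fix y assume "y \<in> W + K"
    then obtain w k where "w \<in> W" "k \<in> K" "y = w + k" by (rule set_plus_elim)
    then show "y \<in> Y" using vs.subspace_add[OF Y(1), of w k] W(2) N(3) KY by auto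
  next
    fix y assume y: "y \<in> Y"
    obtain m where m: "m \<in> N" "y - m \<in> perp N" by (rule projection[OF N(1,2)])
    have s: "y - m \<in> S" unfolding S_def using m vs.subspace_diff[OF Y(1) y subsetD[OF N(3) m(1)]] by simp
    have "m \<in> G + W" using m(1) by (simp only: G(3))
    then obtain a w where aw: "a \<in> G" "w \<in> W" "m = a + w" by (rule set_plus_elim)
    have "a + (y - m) \<in> K" unfolding K_def using aw(1) s by (rule set_plus_intro)
    with aw(2) have "w + (a + (y - m)) \<in> W + K" by (rule set_plus_intro)
    then show "y \<in> W + K" by (simp add: aw(3) algebra_simps)
  qed
  have dir: "g ` E \<inter> K = {0}"
    unfolding gE W_def[symmetric]
  proof (intro equalityI subsetI)
    fix w assume "w \<in> W \<inter> K"
    then have w: "w \<in> W" "w \<in> G + S" by (simp_all add: K_def)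
    from w(2) obtain a s where as: "a \<in> G" "s \<in> S" "w = a + s" by (rule set_plus_elim)
    have "w - a \<in> N" by (rule vs.subspace_diff[OF N(1) subsetD[OF W(2) w(1)] subsetD[OF GN as(1)]])
    then have "s \<in> N \<inter> S" using as by simp
    then have "s = 0" using NS by simp
    then have "w \<in> G \<inter> W" using as w(1) by simp
    then show "w \<in> {0}" using G(2) by simp
  qed (use vs.subspace_0[OF W(1)] vs.subspace_0[OF sK] in simp)
  have inj: "x = 0" if "x \<in> E" "g x = 0" for x
  proof -
    have "x \<in> Z" using that E(3) by (auto simp: Z_def ker_on_def)
    then have "x \<in> Z \<inter> E" using that(1) by simp
    then show "x = 0" using ZE by simp
  qed
  have "\<exists>\<epsilon>>0. \<forall>g'. bounded_linear_on E g' \<longrightarrow> g' ` E \<subseteq> Y \<longrightarrow>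
    (\<forall>x\<in>E. norm (g' x - g x) \<le> \<epsilon> * norm x) \<longrightarrow>
    g' ` E + K = Y \<and> g' ` E \<inter> K = {0} \<and> (\<forall>x\<in>E. g' x = 0 \<longrightarrow> x = 0)"
    by (rule direct_sum_stable[OF bounded_operators_bounded[OF g E] real_subspace[OF sK] cK real_subspace[OF Y(1)] Y(2) sum dir])
      (rule inj)
  then obtain \<epsilon> where \<epsilon>: "\<epsilon> > 0" "\<forall>g'. bounded_linear_on E g' \<longrightarrow> g' ` E \<subseteq> Y \<longrightarrow>
    (\<forall>x\<in>E. norm (g' x - g x) \<le> \<epsilon> * norm x) \<longrightarrow>
    g' ` E + K = Y \<and> g' ` E \<inter> K = {0} \<and> (\<forall>x\<in>E. g' x = 0 \<longrightarrow> x = 0)" by (elim exE conjE)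
  have "ker_on E g' = {0} \<and> g' ` E + K = Y \<and> g' ` E \<inter> K = {0}"
    if g': "g' \<in> bounded_operators smul X Y" and close: "\<forall>x\<in>X. norm (g' x - g x) \<le> \<epsilon> * norm x" for g'
  proof -
    interpret g': bounded_linear_on E g' by (rule bounded_operators_bounded[OF g' E])
    have "g' ` E \<subseteq> Y" using g' E(3) by (auto simp: bounded_operators_def)
    moreover have "\<forall>x\<in>E. norm (g' x - g x) \<le> \<epsilon> * norm x" using close E(3) by blast
    ultimately have *: "g' ` E + K = Y \<and> g' ` E \<inter> K = {0} \<and> (\<forall>x\<in>E. g' x = 0 \<longrightarrow> x = 0)"
      using \<epsilon>(2) g'.bounded_linear_on_axioms by (elim allE impE)
    have "ker_on E g' = {0}" using * g'.zero vs.subspace_0[OF E(1)] by (auto simp: ker_on_def)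
    with * show ?thesis by simp
  qed
  then show thesis
    by (intro that[OF has_codim_trans[OF XD DE] sK cK KY \<epsilon>(1)] ballI impI)
qed

section \<open>Stability of the index\<close>

lemma hilbert_sequence_linear:
  assumes "hilbert_sequence smul n H \<delta>" shows "linear_sequence n H \<delta>"
  unfolding linear_sequence_def
proof (intro conjI allI)
  fix p
  have *: "vs.subspace (H p)" "\<delta> p \<in> bounded_operators smul (H p) (H (p - 1))"
    "p < 0 \<or> p \<ge> int n + 1 \<longrightarrow> H p = {0}"
    using assms by (simp_all add: hilbert_sequence_def)
  show "linear_on (H p) (\<delta> p)" by (rule bounded_operators_linear[OF *(2,1)])
  show "\<delta> p ` H p \<subseteq> H (p - 1)" using *(2) by (simp add: bounded_operators_def)
  show "p < 0 \<or> p \<ge> int n + 1 \<longrightarrow> H p = {0}" by (rule *(3))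
qed

lemma bounded_operators_restrict:
  assumes "f \<in> bounded_operators smul X Y" "X' \<subseteq> X" "f ` X' \<subseteq> Y'"
  shows "f \<in> bounded_operators smul X' Y'"
  using assms unfolding bounded_operators_def by (simp add: subset_iff) meson

lemma hilbert_sequence_restrict:
  assumes H: "hilbert_sequence smul n H \<delta>" and H': "linear_sequence m H' \<delta>"
    and sub: "\<And>p. H' p \<subseteq> H p" and closed: "\<And>p. closed (H' p)"
  shows "hilbert_sequence smul m H' \<delta>"
proof -
  have lin: "linear_on (H' p) (\<delta> p)" "\<delta> p ` H' p \<subseteq> H' (p - 1)"
    "p < 0 \<or> p \<ge> int m + 1 \<Longrightarrow> H' p = {0}" for p
    by (rule linear_sequenceD[OF H'], rule linear_sequenceD[OF H'], rule linear_sequenceD(3)[OF H'])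
  have bdd: "\<delta> p \<in> bounded_operators smul (H p) (H (p - 1))" for p
    using H by (simp add: hilbert_sequence_def)
  show ?thesis
    unfolding hilbert_sequence_def
  proof (intro conjI allI impI)
    fix p
    show "vs.subspace (H' p)" by (rule linear_on_subspace[OF lin(1)])
    show "closed (H' p)" by (rule closed)
    show "\<delta> p \<in> bounded_operators smul (H' p) (H' (p - 1))"
      by (rule bounded_operators_restrict[OF bdd sub lin(2)])
  next
    fix p assume "p < 0 \<or> p \<ge> int m + 1"
    then have "H' p = {0}" by (rule lin(3))
    then show "H' p = {0}" "\<forall>x\<in>H' p. \<delta> p x = 0" using linear_on_zero[OF lin(1)] by simp_all
  qed
qed

text \<open>In the induction step the pair \<open>E\<close>, \<open>K\<close> is chosen for \<open>\<delta>\<close> and used to shorten both sequences.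
The condition that products of consecutive operators have finite rank is inherited by the
shorter sequences, and \<open>\<delta>\<close> itself satisfies it because \<open>\<delta> p\<close> kills a subspace of finite
codimension in the range of \<open>\<delta> (p + 1)\<close>.\<close>

lemma fredholm_index_stable:
  assumes "hilbert_sequence smul n H \<delta>" "fredholm_with H \<delta> t"
  shows "\<exists>\<epsilon>>0. \<forall>\<delta>'. hilbert_sequence smul n H \<delta>' \<longrightarrow>
    (\<forall>p. \<exists>d. has_codim (\<delta>' p ` \<delta>' (p + 1) ` H (p + 1)) {0} d) \<longrightarrow>
    (\<forall>p. \<forall>x\<in>H p. norm (\<delta>' p x - \<delta> p x) \<le> \<epsilon> * norm x) \<longrightarrow>
    (\<exists>t'. fredholm_with H \<delta>' t' \<and> alternating_sum n t' = alternating_sum n t)"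
  using assms
proof (induction n arbitrary: H t)
  case 0
  have zero: "\<delta>' p x = 0" if d: "hilbert_sequence smul 0 H \<delta>'" and x: "x \<in> H p" for \<delta>' p x
  proof (cases "p = 0")
    case True
    have "\<delta>' p x \<in> H (p - 1)"
      using subsetD[OF linear_sequenceD(2)[OF hilbert_sequence_linear[OF d]] imageI[OF x]] .
    moreover have "H (p - 1) = {0}" using d True by (simp add: hilbert_sequence_def)
    ultimately show ?thesis by simp
  next
    case False
    then have "p < 0 \<or> p \<ge> int 0 + 1" by simp linarith
    then show ?thesis using d x unfolding hilbert_sequence_def by blast
  qed
  have "fredholm_with H \<delta>' t" if d: "hilbert_sequence smul 0 H \<delta>'" for \<delta>'
  proof -
    have "Ns H \<delta>' p = Ns H \<delta> p" for p
      using zero[OF d] zero[OF "0.prems"(1)] by (auto simp: ker_on_def)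
    moreover have "Rs H \<delta>' p = Rs H \<delta> p" for p
      by (rule image_cong[OF HOL.refl]) (simp add: zero[OF d] zero[OF "0.prems"(1)])
    ultimately show ?thesis using "0.prems"(2) by (simp add: fredholm_with_def)
  qed
  then show ?case by (intro exI[of _ 1]) auto
next
  case (Suc m)
  let ?q = "int m"
  note H = Suc.prems(1) and t = Suc.prems(2)
  have tp: "commensurable (Ns H \<delta> p) (Rs H \<delta> (p + 1)) (t p)" for p
    using t by (simp add: fredholm_with_def)
  have sub: "vs.subspace (H p)" and cl: "closed (H p)" for p
    using H by (simp_all add: hilbert_sequence_def)
  have bdd: "\<delta>' p \<in> bounded_operators smul (H p) (H (p - 1))"
    if "hilbert_sequence smul (Suc m) H \<delta>'" for \<delta>' p
    using that by (simp add: hilbert_sequence_def)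
  have lin: "linear_on (H p) (\<delta> p)" for p
    by (rule bounded_operators_linear[OF bdd[OF H] sub])
  have into: "Rs H \<delta> (p + 1) \<subseteq> H p" for p
    using bdd[OF H, of "p + 1"] by (simp add: bounded_operators_def)
  have fin: "\<exists>d. has_codim (\<delta> p ` \<delta> (p + 1) ` H (p + 1)) {0} d" for p
  proof -
    let ?R = "Rs H \<delta> (p + 1)"
    obtain b where b: "has_codim ?R (Ns H \<delta> p \<inter> ?R) b"
      by (rule commensurable_Int[OF tp[of p]])
    obtain d where d: "has_codim (\<delta> p ` ?R) (\<delta> p ` (Ns H \<delta> p \<inter> ?R)) d"
      by (rule has_codim_image_kernel[OF b lin into])
    have "0 \<in> Ns H \<delta> p \<inter> ?R" by (rule vs.subspace_0[OF has_codim_subspace(2)[OF b]])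
    then have "\<delta> p ` (Ns H \<delta> p \<inter> ?R) = {0}" by (force simp: ker_on_def)
    then show ?thesis using d by (intro exI[of _ d]) simp
  qed
  let ?g = "\<delta> (?q + 1)" and ?X = "H (?q + 1)" and ?Y = "H ?q" and ?N = "Ns H \<delta> ?q"
  have bdd': "\<delta>' (?q + 1) \<in> bounded_operators smul ?X ?Y"
    if "hilbert_sequence smul (Suc m) H \<delta>'" for \<delta>'
    using bdd[OF that, of "?q + 1"] by simp
  interpret q: bounded_linear_on ?Y "\<delta> ?q"
    by (rule bounded_operators_bounded[OF bdd[OF H] sub cl order.refl])
  have N: "vs.subspace ?N" "closed ?N" "?N \<subseteq> ?Y"
    using subspace_kernel[OF lin] q.closed_preimage[of "{0}"] by (auto simp: ker_on_def)
  obtain c r where cr: "has_codim ?N (?N \<inter> ?g ` ?X) c" "has_codim (?g ` ?X) (?N \<inter> ?g ` ?X) r"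
    by (rule commensurable_Int[OF tp[of ?q]])
  obtain b where b: "has_codim (ker_on ?X ?g) {0} b"
  proof -
    have "H (?q + 1 + 1) = {0}" using H by (simp add: hilbert_sequence_def)
    then have "Rs H \<delta> (?q + 1 + 1) = {0}" using linear_on_zero[OF lin, of "?q + 1 + 1"] by simp
    then have "commensurable (ker_on ?X ?g) {0} (t (?q + 1))" using tp[of "?q + 1"] by simp
    moreover have "{0} \<subseteq> ker_on ?X ?g" using vs.subspace_0[OF subspace_kernel[OF lin]] by simp
    ultimately show thesis using that by (rule commensurable_nested)
  qed
  obtain E l K \<epsilon>0 where E: "has_codim ?X E l" and K: "vs.subspace K" "closed K" "K \<subseteq> ?Y"
    and \<epsilon>0: "\<epsilon>0 > 0" and stable: "\<forall>g'\<in>bounded_operators smul ?X ?Y.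
      (\<forall>x\<in>?X. norm (g' x - ?g x) \<le> \<epsilon>0 * norm x) \<longrightarrow>
      ker_on E g' = {0} \<and> g' ` E + K = ?Y \<and> g' ` E \<inter> K = {0}"
    by (rule stable_splitting[OF sub cl sub cl bdd'[OF H] N cr b])
  have split: "ker_on E (\<delta>' (?q + 1)) = {0} \<and> \<delta>' (?q + 1) ` E + K = ?Y \<and> \<delta>' (?q + 1) ` E \<inter> K = {0}"
    if "hilbert_sequence smul (Suc m) H \<delta>'" "\<And>x. x \<in> ?X \<Longrightarrow> norm (\<delta>' (?q + 1) x - ?g x) \<le> \<epsilon>0 * norm x" for \<delta>'
    using bspec[OF stable bdd'[OF that(1)]] that(2) by blast
  define H' where "H' = H(?q + 1 := {0}, ?q := K)"
  have H'sub: "H' p \<subseteq> H p" for p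
    using K(3) vs.subspace_0[OF sub[of p]] by (cases "p = ?q + 1") (simp_all add: H'_def)
  have H'cl: "closed (H' p)" for p
    using K(2) cl[of p] by (cases "p = ?q + 1") (simp_all add: H'_def)
  define s where "s = (if even m then - 1 else 1) * int l"
  note reduce = reduce_sequence[where H = H and K = K and m = m and E = E and l = l, folded H'_def s_def]
  have sp: "ker_on E ?g = {0} \<and> ?g ` E + K = ?Y \<and> ?g ` E \<inter> K = {0}"
    by (rule split[OF H]) (use \<epsilon>0 in simp)
  note sp1 = conjunct1[OF sp] conjunct1[OF conjunct2[OF sp]] conjunct2[OF conjunct2[OF sp]]
  note seq = hilbert_sequence_linear[OF H]
  from reduce(2)[OF seq fin E sp1(1) K(1) sp1(2,3) t]
  obtain t1 where t1: "fredholm_with H' \<delta> t1" "alternating_sum (Suc m) t = alternating_sum m t1 + s"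
    by (elim exE conjE)
  have "hilbert_sequence smul m H' \<delta>"
    by (rule hilbert_sequence_restrict[OF H reduce(1)[OF seq fin E sp1(1) K(1) sp1(2,3)] H'sub H'cl])
  from Suc.IH[OF this t1(1)] obtain \<epsilon>1 where \<epsilon>1: "\<epsilon>1 > 0" and IH: "\<forall>\<delta>'. hilbert_sequence smul m H' \<delta>' \<longrightarrow>
    (\<forall>p. \<exists>d. has_codim (\<delta>' p ` \<delta>' (p + 1) ` H' (p + 1)) {0} d) \<longrightarrow>
    (\<forall>p. \<forall>x\<in>H' p. norm (\<delta>' p x - \<delta> p x) \<le> \<epsilon>1 * norm x) \<longrightarrow>
    (\<exists>t'. fredholm_with H' \<delta>' t' \<and> alternating_sum m t' = alternating_sum m t1)" by (elim exE conjE)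
  define \<epsilon> where "\<epsilon> = min \<epsilon>0 \<epsilon>1"
  have \<epsilon>: "\<epsilon> > 0" "\<epsilon> \<le> \<epsilon>0" "\<epsilon> \<le> \<epsilon>1" using \<epsilon>0 \<epsilon>1 by (simp_all add: \<epsilon>_def)
  have "\<exists>t'. fredholm_with H \<delta>' t' \<and> alternating_sum (Suc m) t' = alternating_sum (Suc m) t"
    if d: "hilbert_sequence smul (Suc m) H \<delta>'"
      and fin': "\<forall>p. \<exists>d. has_codim (\<delta>' p ` \<delta>' (p + 1) ` H (p + 1)) {0} d"
      and close: "\<forall>p. \<forall>x\<in>H p. norm (\<delta>' p x - \<delta> p x) \<le> \<epsilon> * norm x" for \<delta>'
  proof -
    have near: "norm (\<delta>' p x - \<delta> p x) \<le> \<epsilon>' * norm x" if "x \<in> H p" "\<epsilon> \<le> \<epsilon>'" for p x \<epsilon>'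
      using close[rule_format, OF that(1)] mult_right_mono[OF that(2) norm_ge_zero[of x]] by (rule order.trans)
    have "ker_on E (\<delta>' (?q + 1)) = {0} \<and> \<delta>' (?q + 1) ` E + K = ?Y \<and> \<delta>' (?q + 1) ` E \<inter> K = {0}"
      by (rule split[OF d near[OF _ \<epsilon>(2)]])
    note sp' = conjunct1[OF this] conjunct1[OF conjunct2[OF this]] conjunct2[OF conjunct2[OF this]]
    note seq' = hilbert_sequence_linear[OF d]
    note fin'' = fin'[rule_format]
    have seqm: "linear_sequence m H' \<delta>'" by (rule reduce(1)[OF seq' fin'' E sp'(1) K(1) sp'(2,3)])
    have h': "hilbert_sequence smul m H' \<delta>'"
      by (rule hilbert_sequence_restrict[OF d seqm H'sub H'cl])
    have fin1: "\<forall>p. \<exists>d. has_codim (\<delta>' p ` \<delta>' (p + 1) ` H' (p + 1)) {0} d"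
    proof
      fix p
      from fin'' obtain d where dd: "has_codim (\<delta>' p ` \<delta>' (p + 1) ` H (p + 1)) {0} d" ..
      have l: "linear_on (H' r) (\<delta>' r)" "\<delta>' r ` H' r \<subseteq> H' (r - 1)" for r
        using seqm by (simp_all add: linear_sequence_def)
      have "\<delta>' (p + 1) ` H' (p + 1) \<subseteq> H' p" using l(2)[of "p + 1"] by simp
      then have s: "vs.subspace (\<delta>' p ` \<delta>' (p + 1) ` H' (p + 1))"
        by (rule subspace_image_on[OF l(1) subspace_image_on[OF l(1) linear_on_subspace[OF l(1)] order.refl]])
      have z: "{0} \<subseteq> \<delta>' p ` \<delta>' (p + 1) ` H' (p + 1)" using vs.subspace_0[OF s] by simp
      obtain e where "has_codim (\<delta>' p ` \<delta>' (p + 1) ` H' (p + 1)) {0} e"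
        by (rule has_codim_between[OF dd s z image_mono[OF image_mono[OF H'sub]]])
      then show "\<exists>d. has_codim (\<delta>' p ` \<delta>' (p + 1) ` H' (p + 1)) {0} d" by (rule exI)
    qed
    have close1: "\<forall>p. \<forall>x\<in>H' p. norm (\<delta>' p x - \<delta> p x) \<le> \<epsilon>1 * norm x"
      using near[OF subsetD[OF H'sub] \<epsilon>(3)] by blast
    from mp[OF mp[OF mp[OF spec[OF IH] h'] fin1] close1] obtain t1' where t1': "fredholm_with H' \<delta>' t1'" "alternating_sum m t1' = alternating_sum m t1"
      by (elim exE conjE)
    from reduce(3)[OF seq' fin'' E sp'(1) K(1) sp'(2,3) t1'(1)]
    obtain t' where t': "fredholm_with H \<delta>' t'" "alternating_sum (Suc m) t' = alternating_sum m t1' + s"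
      by (elim exE conjE)
    then have "alternating_sum (Suc m) t' = alternating_sum (Suc m) t" using t1(2) t1'(2) by simp
    with t'(1) show ?thesis by (intro exI conjI)
  qed
  then show ?case using \<epsilon>(1) by blast
qed

lemma fredholm_with_outside:
  assumes H: "hilbert_sequence smul n H \<delta>" and t: "fredholm_with H \<delta> t" and p: "p < 0 \<or> p \<ge> int n + 1"
  shows "t p = 0"
proof -
  note seq = hilbert_sequence_linear[OF H]
  have Hp: "H p = {0}" by (rule linear_sequenceD(3)[OF seq p])
  have z: "\<delta> r 0 = 0" for r
    by (rule linear_on_zero[OF linear_sequenceD(1)[OF seq]])
  have "Rs H \<delta> (p + 1) \<subseteq> H (p + 1 - 1)" by (rule linear_sequenceD(2)[OF seq])
  then have "Rs H \<delta> (p + 1) \<subseteq> {0}" using Hp by simp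
  moreover have tp: "commensurable (Ns H \<delta> p) (Rs H \<delta> (p + 1)) (t p)" using t by (simp add: fredholm_with_def)
  ultimately have R: "Rs H \<delta> (p + 1) = {0}" using vs.subspace_0[OF commensurable_subspace(2)[OF tp]] by blast
  have N: "Ns H \<delta> p = {0}" using z by (auto simp: ker_on_def Hp)
  have "commensurable {0} {0} 0" using commensurable_codim[OF has_codim.same[OF vs.subspace_single_0]] by simp
  then show ?thesis using commensurable_unique[OF tp[unfolded N R]] by simp
qed

lemma alternating_sum_length:
  assumes "hilbert_sequence smul n H \<delta>" "hilbert_sequence smul n' H \<delta>" "fredholm_with H \<delta> t"
  shows "alternating_sum n t = alternating_sum n' t"
proof -
  have "alternating_sum n t = alternating_sum (max n n') t" if "hilbert_sequence smul n H \<delta>" for n n'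
    unfolding alternating_sum_def
    by (rule sum.mono_neutral_left) (auto simp: fredholm_with_outside[OF that assms(3)])
  from this[OF assms(1), of n'] this[OF assms(2), of n] show ?thesis by (simp add: max.commute)
qed

text \<open>Bounds for the length of sequences with the same spaces are interchangeable, since the spaces
determine where the sequence stops.\<close>

lemma hilbert_sequence_length:
  assumes H: "hilbert_sequence smul n H \<delta>" and H': "hilbert_sequence smul n' H \<delta>'"
  shows "hilbert_sequence smul n H \<delta>'"
proof -
  have 1: "H p = {0}" if "p < 0 \<or> p \<ge> int n + 1" for p
    using H that unfolding hilbert_sequence_def by blast
  have "linear_sequence n H \<delta>'"
    using hilbert_sequence_linear[OF H'] 1 by (simp add: linear_sequence_def)
  moreover have "closed (H p)" for p using H by (simp add: hilbert_sequence_def)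
  ultimately show ?thesis by (intro hilbert_sequence_restrict[OF H']) simp_all
qed

lemma fredholm_chain_iff:
  assumes H: "hilbert_sequence smul n H \<delta>"
  shows "fredholm_chain smul n H \<delta> \<longleftrightarrow> (\<exists>t. fredholm_with H \<delta> t)"
    and "fredholm_with H \<delta> t \<Longrightarrow> chain_index smul n H \<delta> = alternating_sum n t"
proof -
  note seq = hilbert_sequence_linear[OF H]
  have lin: "linear_on (H p) (\<delta> p)" and into: "\<delta> (p + 1) ` H (p + 1) \<subseteq> H p"
    and H0: "p < 0 \<or> p \<ge> int n + 1 \<Longrightarrow> H p = {0}" for p
    using linear_sequenceD[OF seq, of p] linear_sequenceD(2)[OF seq, of "p + 1"] by simp_all
  have N: "vs.subspace (Ns H \<delta> p)" and R: "vs.subspace (Rs H \<delta> (p + 1))" for p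
    by (rule subspace_kernel[OF lin], rule subspace_image_on[OF lin linear_on_subspace[OF lin] order.refl])
  define i where "i p = int (quotient_dim smul (Ns H \<delta> p) (Ns H \<delta> p \<inter> Rs H \<delta> (p + 1)))
       - int (quotient_dim smul (Rs H \<delta> (p + 1)) (Ns H \<delta> p \<inter> Rs H \<delta> (p + 1)))" for p
  have out: "commensurable (Ns H \<delta> p) (Rs H \<delta> (p + 1)) 0" if "p < 0 \<or> p \<ge> int n + 1" for p
  proof -
    have "Ns H \<delta> p = {0}" "Rs H \<delta> (p + 1) = {0}"
      using H0[OF that] vs.subspace_0[OF N[of p]] vs.subspace_0[OF R[of p]] into[of p] by (auto simp: ker_on_def)
    then show ?thesis using commensurable_codim[OF has_codim.same[OF vs.subspace_single_0]] by simp
  qed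
  have comm: "commensurable (Ns H \<delta> p) (Rs H \<delta> (p + 1)) j \<longleftrightarrow>
      quotient_finite_dim smul (Ns H \<delta> p) (Ns H \<delta> p \<inter> Rs H \<delta> (p + 1)) \<and>
      quotient_finite_dim smul (Rs H \<delta> (p + 1)) (Ns H \<delta> p \<inter> Rs H \<delta> (p + 1)) \<and> j = i p" for p j
    unfolding i_def by (rule commensurable_iff_quotients[OF N R])
  show "fredholm_chain smul n H \<delta> \<longleftrightarrow> (\<exists>t. fredholm_with H \<delta> t)"
  proof
    assume F: "fredholm_chain smul n H \<delta>"
    have "commensurable (Ns H \<delta> p) (Rs H \<delta> (p + 1)) (if p \<in> {0..int n} then i p else 0)" for p
    proof (cases "p \<in> {0..int n}")
      case True
      then show ?thesis using F by (simp add: comm fredholm_chain_def)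
    next
      case False
      then have "p < 0 \<or> p \<ge> int n + 1" by auto
      then show ?thesis using out[of p] by (simp only: False if_False)
    qed
    then show "\<exists>t. fredholm_with H \<delta> t" unfolding fredholm_with_def by (intro exI allI)
  next
    assume "\<exists>t. fredholm_with H \<delta> t"
    then show "fredholm_chain smul n H \<delta>" by (auto simp: fredholm_chain_def H fredholm_with_def comm)
  qed
  assume t: "fredholm_with H \<delta> t"
  then have ti: "t p = i p" for p by (simp add: fredholm_with_def comm)
  have "alternating_sum n t = (\<Sum>p\<in>{0..int n}. (if even p then 1 else -1) * t p)"
    unfolding alternating_sum_def
    by (rule sum.mono_neutral_right) (auto simp: fredholm_with_outside[OF H t])
  also have "\<dots> = (\<Sum>p\<in>{0..int n}. (- 1) ^ nat p * i p)"
    by (rule sum.cong[OF HOL.refl]) (simp add: ti even_nat_iff minus_one_power_iff)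
  also have "\<dots> = chain_index smul n H \<delta>" by (simp only: chain_index_def i_def)
  finally show "chain_index smul n H \<delta> = alternating_sum n t" ..
qed

lemma norm_diff_le_onorm_on:
  assumes f: "f \<in> bounded_operators smul X Y" and g: "g \<in> bounded_operators smul X Y'" and x: "x \<in> X"
    and lin: "vs.subspace X"
  shows "norm (f x - g x) \<le> onorm_on X (\<lambda>x. f x - g x) * norm x"
proof (cases "x = 0")
  case True
  then show ?thesis using linear_on_zero[OF bounded_operators_linear[OF f lin]]
      linear_on_zero[OF bounded_operators_linear[OF g lin]] by simp
next
  case False
  obtain K L where K: "\<forall>x\<in>X. norm (f x) \<le> K * norm x" and L: "\<forall>x\<in>X. norm (g x) \<le> L * norm x"
    using f g by (auto simp: bounded_operators_def)
  have "norm (f y - g y) / norm y \<le> \<bar>K + L\<bar>" if "y \<in> X" for y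
  proof (cases "y = 0")
    case False
    have "norm (f y - g y) \<le> norm (f y) + norm (g y)" by (rule norm_triangle_ineq4)
    also have "\<dots> \<le> K * norm y + L * norm y" using K L that by (intro add_mono) simp_all
    also have "\<dots> \<le> \<bar>K + L\<bar> * norm y" unfolding distrib_right[symmetric] by (rule mult_right_mono) simp_all
    finally show ?thesis using False by (simp add: pos_divide_le_eq)
  qed simp
  then have "bdd_above ((\<lambda>x. norm (f x - g x) / norm x) ` X)" by (rule bdd_aboveI2)
  from cSUP_upper[OF x this] have "norm (f x - g x) / norm x \<le> onorm_on X (\<lambda>x. f x - g x)"
    by (simp only: onorm_on_def)
  then show ?thesis using False by (simp add: pos_divide_le_eq)
qed

end

theorem theorem6p5:
  fixes smul :: "'k::real_or_complex \<Rightarrow> 'a::{real_inner, complete_space} \<Rightarrow> 'a"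
    and ip :: "'a \<Rightarrow> 'a \<Rightarrow> 'k"
    and n :: nat
    and H :: "int \<Rightarrow> 'a set"
    and \<delta> :: "int \<Rightarrow> 'a \<Rightarrow> 'a"
  assumes "hilbert_space smul ip"
    and "fredholm_chain smul n H \<delta>"
  shows "\<exists>\<epsilon>>0. \<forall>(n'::nat) (\<delta>'::int \<Rightarrow> 'a \<Rightarrow> 'a).
    hilbert_sequence smul n' H \<delta>' \<longrightarrow>
    (\<forall>p. finite_dim smul ((\<delta>' p \<circ> \<delta>' (p + 1)) ` H (p + 1))) \<longrightarrow>
    (\<forall>p. onorm_on (H p) (\<lambda>x. \<delta> p x - \<delta>' p x) < \<epsilon>) \<longrightarrow>
    fredholm_chain smul n' H \<delta>' \<and> chain_index smul n H \<delta> = chain_index smul n' H \<delta>'"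
proof -
  interpret hs: hilbert_space smul ip by (rule assms(1))
  interpret hilbert_algebra smul ip by unfold_locales
  have H: "hilbert_sequence smul n H \<delta>" using assms(2) by (simp add: fredholm_chain_def)
  from assms(2) obtain t where t: "fredholm_with H \<delta> t" unfolding fredholm_chain_iff(1)[OF H] ..
  from fredholm_index_stable[OF H t] obtain \<epsilon> where \<epsilon>: "\<epsilon> > 0" and stable:
    "\<forall>\<delta>'. hilbert_sequence smul n H \<delta>' \<longrightarrow>
      (\<forall>p. \<exists>d. has_codim (\<delta>' p ` \<delta>' (p + 1) ` H (p + 1)) {0} d) \<longrightarrow>
      (\<forall>p. \<forall>x\<in>H p. norm (\<delta>' p x - \<delta> p x) \<le> \<epsilon> * norm x) \<longrightarrow>
      (\<exists>t'. fredholm_with H \<delta>' t' \<and> alternating_sum n t' = alternating_sum n t)" by (elim exE conjE)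
  have "fredholm_chain smul n' H \<delta>' \<and> chain_index smul n H \<delta> = chain_index smul n' H \<delta>'"
    if H': "hilbert_sequence smul n' H \<delta>'"
      and fin: "\<forall>p. finite_dim smul ((\<delta>' p \<circ> \<delta>' (p + 1)) ` H (p + 1))"
      and close: "\<forall>p. onorm_on (H p) (\<lambda>x. \<delta> p x - \<delta>' p x) < \<epsilon>" for n' \<delta>'
  proof -
    have Hn: "hilbert_sequence smul n H \<delta>'" by (rule hilbert_sequence_length[OF H H'])
    have fin': "\<forall>p. \<exists>d. has_codim (\<delta>' p ` \<delta>' (p + 1) ` H (p + 1)) {0} d"
    proof
      fix p
      obtain d where "has_codim ((\<delta>' p \<circ> \<delta>' (p + 1)) ` H (p + 1)) {0} d"
        by (rule finite_dim_has_codim[OF spec[OF fin]])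
      then show "\<exists>d. has_codim (\<delta>' p ` \<delta>' (p + 1) ` H (p + 1)) {0} d"
        unfolding image_comp by (rule exI)
    qed
    have close': "\<forall>p. \<forall>x\<in>H p. norm (\<delta>' p x - \<delta> p x) \<le> \<epsilon> * norm x"
    proof (intro allI ballI)
      fix p x assume x: "x \<in> H p"
      have bdd: "\<delta> p \<in> bounded_operators smul (H p) (H (p - 1))" "\<delta>' p \<in> bounded_operators smul (H p) (H (p - 1))"
        "module.subspace smul (H p)"
        using H H' by (simp_all add: hilbert_sequence_def)
      have "norm (\<delta> p x - \<delta>' p x) \<le> onorm_on (H p) (\<lambda>x. \<delta> p x - \<delta>' p x) * norm x"
        by (rule norm_diff_le_onorm_on[OF bdd(1,2) x bdd(3)])
      also have "\<dots> \<le> \<epsilon> * norm x" by (rule mult_right_mono[OF less_imp_le[OF spec[OF close]] norm_ge_zero])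
      finally show "norm (\<delta>' p x - \<delta> p x) \<le> \<epsilon> * norm x" by (simp only: norm_minus_commute)
    qed
    from mp[OF mp[OF mp[OF spec[OF stable] Hn] fin'] close'] obtain t' where t': "fredholm_with H \<delta>' t'" "alternating_sum n t' = alternating_sum n t" by (elim exE conjE)
    have "fredholm_chain smul n' H \<delta>'" using fredholm_chain_iff(1)[OF H'] t'(1) by blast
    moreover have "chain_index smul n H \<delta> = chain_index smul n' H \<delta>'"
      using fredholm_chain_iff(2)[OF H t] fredholm_chain_iff(2)[OF H' t'(1)]
        alternating_sum_length[OF Hn H' t'(1)] t'(2) by simp
    ultimately show ?thesis ..
  qed
  with \<epsilon> show ?thesis by blast
qed

end
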